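(* Let $R$ be a ring with unity and let $\mathcal{X}$ be a semibrick of left $R$-modules. The category $\mathrm{Filt}(\mathcal{X})$ (as a full subcategory of the category of left $R$-modules) is closed under extensions, kernels and images.
   Context: A brick is a finitely presented left $R$-module whose endomorphism ring is a division ring. A semibrick is a class $\mathcal{X}$ of pairwise non-isomorphic bricks with $\mathrm{Hom}(X,X')=0$ for distinct $X,X'\in\mathcal{X}$. A filtration of a module $M$ is an ascending chain $(M_\lambda,\lambda\le\mu)$ of submodules ($\mu$ an ordinal) with $M_0=0$, $M_\mu=M$ and $M_\nu=\bigcup_{\lambda<\nu}M_\lambda$ for limit ordinals $\nu\le\mu$. It is an $\mathcal{X}$-filtration if each $M_{\lambda+1}/M_\lambda$ ($\lambda<\mu$) is isomorphic to a module in $\mathcal{X}$. $\mathrm{Filt}(\mathcal{X})$ is the class of modules admitting an $\mathcal{X}$-filtration. Closed under kernels (images) means that for every homomorphism $f:M\to N$ with $M,N\in\mathrm{Filt}(\mathcal{X})$ the kernel (image) of $f$ in the category of all $R$-modules lies in $\mathrm{Filt}(\mathcal{X})$. *)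

theory Defs
  imports "HOL-Algebra.Module" "HOL-Algebra.AbelCoset"
begin

section \<open>Left modules over a not necessarily commutative ring\<close>

text \<open>The locale \<^locale>\<open>module\<close> of HOL-Algebra requires a commutative ring of scalars. The following
  has the same axioms over an arbitrary ring with unity, on the same record type.\<close>

locale left_module = R?: ring R + M?: abelian_group M
  for R :: "('r, 'k) ring_scheme" (structure) and M :: "('r, 'b) module" (structure) +
  assumes smult_closed:
      "\<lbrakk>a \<in> carrier R; x \<in> carrier M\<rbrakk> \<Longrightarrow> a \<odot>\<^bsub>M\<^esub> x \<in> carrier M"
    and smult_l_distr:
      "\<lbrakk>a \<in> carrier R; b \<in> carrier R; x \<in> carrier M\<rbrakk> \<Longrightarrow>
        (a \<oplus> b) \<odot>\<^bsub>M\<^esub> x = a \<odot>\<^bsub>M\<^esub> x \<oplus>\<^bsub>M\<^esub> b \<odot>\<^bsub>M\<^esub> x"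
    and smult_r_distr:
      "\<lbrakk>a \<in> carrier R; x \<in> carrier M; y \<in> carrier M\<rbrakk> \<Longrightarrow>
        a \<odot>\<^bsub>M\<^esub> (x \<oplus>\<^bsub>M\<^esub> y) = a \<odot>\<^bsub>M\<^esub> x \<oplus>\<^bsub>M\<^esub> a \<odot>\<^bsub>M\<^esub> y"
    and smult_assoc:
      "\<lbrakk>a \<in> carrier R; b \<in> carrier R; x \<in> carrier M\<rbrakk> \<Longrightarrow>
        (a \<otimes> b) \<odot>\<^bsub>M\<^esub> x = a \<odot>\<^bsub>M\<^esub> (b \<odot>\<^bsub>M\<^esub> x)"
    and smult_one: "x \<in> carrier M \<Longrightarrow> \<one> \<odot>\<^bsub>M\<^esub> x = x"

text \<open>A homomorphism is a function on the whole type; only its values on the carrier matter.\<close>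

definition lmod_hom ::
    "('r, 'k) ring_scheme \<Rightarrow> ('r, 'b) module \<Rightarrow> ('r, 'c) module \<Rightarrow> ('b \<Rightarrow> 'c) set" where
  "lmod_hom R M N =
    {f \<in> carrier M \<rightarrow> carrier N.
      (\<forall>x\<in>carrier M. \<forall>y\<in>carrier M. f (x \<oplus>\<^bsub>M\<^esub> y) = f x \<oplus>\<^bsub>N\<^esub> f y) \<and>
      (\<forall>a\<in>carrier R. \<forall>x\<in>carrier M. f (a \<odot>\<^bsub>M\<^esub> x) = a \<odot>\<^bsub>N\<^esub> f x)}"

definition lmod_isomorphic ::
    "('r, 'k) ring_scheme \<Rightarrow> ('r, 'b) module \<Rightarrow> ('r, 'c) module \<Rightarrow> bool" where
  "lmod_isomorphic R M N \<longleftrightarrow> (\<exists>f \<in> lmod_hom R M N. bij_betw f (carrier M) (carrier N))"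

definition short_exact ::
    "('r, 'k) ring_scheme \<Rightarrow> ('r, 'b) module \<Rightarrow> ('b \<Rightarrow> 'c) \<Rightarrow> ('r, 'c) module \<Rightarrow> ('c \<Rightarrow> 'd) \<Rightarrow>
      ('r, 'd) module \<Rightarrow> bool" where
  "short_exact R L f M g N \<longleftrightarrow>
    f \<in> lmod_hom R L M \<and> g \<in> lmod_hom R M N \<and>
    inj_on f (carrier L) \<and> f ` carrier L = a_kernel M N g \<and> g ` carrier M = carrier N"

text \<open>The record type of modules carries ring multiplication fields \<^const>\<open>mult\<close> and \<^const>\<open>one\<close>,
  which play no role for modules.\<close>

definition quotient_module :: "('r, 'b) module \<Rightarrow> 'b set \<Rightarrow> ('r, 'b set) module" where
  "quotient_module M N =
    \<lparr>carrier = a_rcosets\<^bsub>M\<^esub> N, mult = undefined, one = undefined,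
     zero = N, add = set_add M,
     smult = (\<lambda>a C. \<Union>x\<in>C. N +>\<^bsub>M\<^esub> (a \<odot>\<^bsub>M\<^esub> x))\<rparr>"


section \<open>Bricks and semibricks\<close>

definition free_module :: "('r, 'k) ring_scheme \<Rightarrow> nat \<Rightarrow> ('r, nat \<Rightarrow> 'r) module" where
  "free_module R n =
    \<lparr>carrier = {..<n} \<rightarrow>\<^sub>E carrier R, mult = undefined, one = undefined,
     zero = (\<lambda>i\<in>{..<n}. \<zero>\<^bsub>R\<^esub>),
     add = (\<lambda>v w. \<lambda>i\<in>{..<n}. v i \<oplus>\<^bsub>R\<^esub> w i),
     smult = (\<lambda>a v. \<lambda>i\<in>{..<n}. a \<otimes>\<^bsub>R\<^esub> v i)\<rparr>"

text \<open>Finite presentation: an exact sequence \<open>R\<^sup>m \<rightarrow> R\<^sup>n \<rightarrow> M \<rightarrow> 0\<close>.\<close>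

definition finitely_presented :: "('r, 'k) ring_scheme \<Rightarrow> ('r, 'b) module \<Rightarrow> bool" where
  "finitely_presented R M \<longleftrightarrow> left_module R M \<and>
    (\<exists>m n f g. f \<in> lmod_hom R (free_module R m) (free_module R n) \<and>
      g \<in> lmod_hom R (free_module R n) M \<and>
      f ` carrier (free_module R m) = a_kernel (free_module R n) M g \<and>
      g ` carrier (free_module R n) = carrier M)"

text \<open>Endomorphisms are taken extensional, so that equality of endomorphisms is equality on the
  carrier.\<close>

definition endo_ring :: "('r, 'k) ring_scheme \<Rightarrow> ('r, 'b) module \<Rightarrow> ('b \<Rightarrow> 'b) ring" where
  "endo_ring R M =
    \<lparr>carrier = lmod_hom R M M \<inter> extensional (carrier M),
     mult = compose (carrier M), one = (\<lambda>x\<in>carrier M. x),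
     zero = (\<lambda>x\<in>carrier M. \<zero>\<^bsub>M\<^esub>),
     add = (\<lambda>f g. \<lambda>x\<in>carrier M. f x \<oplus>\<^bsub>M\<^esub> g x)\<rparr>"

locale division_ring = ring +
  assumes one_not_zero: "\<one> \<noteq> \<zero>"
    and division_ring_Units: "Units R = carrier R - {\<zero>}"

definition brick :: "('r, 'k) ring_scheme \<Rightarrow> ('r, 'b) module \<Rightarrow> bool" where
  "brick R M \<longleftrightarrow> finitely_presented R M \<and> division_ring (endo_ring R M)"

definition semibrick :: "('r, 'k) ring_scheme \<Rightarrow> ('r, 'b) module set \<Rightarrow> bool" where
  "semibrick R \<X> \<longleftrightarrow> (\<forall>X\<in>\<X>. brick R X) \<and>
    (\<forall>X\<in>\<X>. \<forall>Y\<in>\<X>. X \<noteq> Y \<longrightarrow>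
      \<not> lmod_isomorphic R X Y \<and>
      (\<forall>f \<in> lmod_hom R X Y. \<forall>x \<in> carrier X. f x = \<zero>\<^bsub>Y\<^esub>))"


section \<open>Filtrations\<close>

text \<open>An ordinal \<open>\<mu>\<close> is represented by a well-order \<open>r\<close> with greatest element \<open>\<mu>\<close>: the elements of
  \<^term>\<open>Field r\<close> are the ordinals \<open>\<alpha> \<le> \<mu>\<close>, the least one is 0 (it has no predecessors), and
  \<open>\<alpha> + 1\<close> is the least element strictly above \<open>\<alpha>\<close>.\<close>

definition wo_limit :: "'i rel \<Rightarrow> 'i \<Rightarrow> bool" where
  "wo_limit r \<nu> \<longleftrightarrow> \<nu> \<in> Field r \<and> underS r \<nu> \<noteq> {} \<and>
    (\<forall>\<alpha> \<in> underS r \<nu>. wo_rel.suc r {\<alpha>} \<noteq> \<nu>)"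

definition filtration ::
    "('r, 'k) ring_scheme \<Rightarrow> ('r, 'b) module \<Rightarrow> 'i rel \<Rightarrow> 'i \<Rightarrow> ('i \<Rightarrow> 'b set) \<Rightarrow> bool" where
  "filtration R M r \<mu> F \<longleftrightarrow>
    Well_order r \<and> \<mu> \<in> Field r \<and> (\<forall>\<alpha> \<in> Field r. (\<alpha>, \<mu>) \<in> r) \<and>
    (\<forall>\<alpha> \<in> Field r. submodule (F \<alpha>) R M) \<and>
    (\<forall>\<alpha> \<beta>. (\<alpha>, \<beta>) \<in> r \<longrightarrow> F \<alpha> \<subseteq> F \<beta>) \<and>
    (\<forall>\<alpha> \<in> Field r. underS r \<alpha> = {} \<longrightarrow> F \<alpha> = {\<zero>\<^bsub>M\<^esub>}) \<and>
    F \<mu> = carrier M \<and>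
    (\<forall>\<nu>. wo_limit r \<nu> \<longrightarrow> F \<nu> = (\<Union>\<alpha> \<in> underS r \<nu>. F \<alpha>))"

definition X_filtration ::
    "('r, 'k) ring_scheme \<Rightarrow> ('r, 'c) module set \<Rightarrow> ('r, 'b) module \<Rightarrow> 'i rel \<Rightarrow> 'i \<Rightarrow>
      ('i \<Rightarrow> 'b set) \<Rightarrow> bool" where
  "X_filtration R \<X> M r \<mu> F \<longleftrightarrow> filtration R M r \<mu> F \<and>
    (\<forall>\<alpha> \<in> Field r - {\<mu>}. \<exists>X \<in> \<X>.
      lmod_isomorphic R (quotient_module (M\<lparr>carrier := F (wo_rel.suc r {\<alpha>})\<rparr>) (F \<alpha>)) X)"

text \<open>Membership in \<open>Filt \<X>\<close>, as a predicate on modules whose elements may have any type \<open>'b\<close>. The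
  existential quantifier over ordinals has to range over well-orders on one fixed type; the type
  \<open>'b set\<close> of the members of the chain suffices: by \<open>X_filtration_imp_Filt\<close> below, an
  \<open>\<X>\<close>-filtration indexed by a well-order on any type whatsoever yields membership.\<close>

definition Filt ::
    "('r, 'k) ring_scheme \<Rightarrow> ('r, 'c) module set \<Rightarrow> ('r, 'b) module \<Rightarrow> bool" where
  "Filt R \<X> M \<longleftrightarrow> left_module R M \<and>
    (\<exists>(r :: 'b set rel) \<mu> F. X_filtration R \<X> M r \<mu> F)"

lemma wo_suc_least:
  assumes "Well_order r" "(a, b) \<in> r" "a \<noteq> b"
  shows "(a, wo_rel.suc r {a}) \<in> r" "a \<noteq> wo_rel.suc r {a}" "(wo_rel.suc r {a}, b) \<in> r"
proof -
  interpret wo_rel r using assms(1) by (simp add: wo_rel_def)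
  have a: "{a} \<subseteq> Field r" and ne: "AboveS {a} \<noteq> {}"
    using assms by (auto simp: Order_Relation.AboveS_def Field_def)
  show "(a, suc {a}) \<in> r" "a \<noteq> suc {a}" using suc_greater[OF a ne] by auto
  show "(suc {a}, b) \<in> r"
    using suc_least_AboveS[of b "{a}"] assms by (auto simp: Order_Relation.AboveS_def Field_def)
qed

lemma wo_suc_eqI:
  assumes r: "Well_order r" and ab: "(a, b) \<in> r" "a \<noteq> b"
    and least: "\<And>c. (a, c) \<in> r \<Longrightarrow> a \<noteq> c \<Longrightarrow> (b, c) \<in> r"
  shows "wo_rel.suc r {a} = b"
proof -
  have "antisym r" using r by (auto simp: order_on_defs)
  then show ?thesis
    using wo_suc_least[OF r ab] least by (meson antisymD)
qed

lemma X_filtration_imp_Filt: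
  fixes r :: "'i rel" and M :: "('r, 'b) module"
  assumes M: "left_module R M" and X: "X_filtration R \<X> M r \<mu> F"
  shows "Filt R \<X> M"
proof -
  have fl: "filtration R M r \<mu> F"
    and fac_all: "\<forall>i \<in> Field r - {\<mu>}. \<exists>X \<in> \<X>.
      lmod_isomorphic R (quotient_module (M\<lparr>carrier := F (wo_rel.suc r {i})\<rparr>) (F i)) X"
    using X unfolding X_filtration_def by - (elim conjE, assumption)+
  have r: "Well_order r" and mu: "\<mu> \<in> Field r" and top: "F \<mu> = carrier M"
    and mu_all: "\<forall>i \<in> Field r. (i, \<mu>) \<in> r"
    and sub_all: "\<forall>i \<in> Field r. submodule (F i) R M"
    and mono_all: "\<forall>i j. (i, j) \<in> r \<longrightarrow> F i \<subseteq> F j"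
    and zero_all: "\<forall>i \<in> Field r. underS r i = {} \<longrightarrow> F i = {\<zero>\<^bsub>M\<^esub>}"
    and lim_all: "\<forall>i. wo_limit r i \<longrightarrow> F i = (\<Union>j \<in> underS r i. F j)"
    using fl unfolding filtration_def by - (elim conjE, assumption)+
  have mu_top: "(i, \<mu>) \<in> r" and sub: "submodule (F i) R M" if "i \<in> Field r" for i
    using mu_all sub_all that by (simp_all only: Ball_def)
  have mono: "F i \<subseteq> F j" if "(i, j) \<in> r" for i j
    using mono_all that by simp
  have zero: "F i = {\<zero>\<^bsub>M\<^esub>}" if "i \<in> Field r" "underS r i = {}" for i
    using zero_all that by simp
  have lim: "F i = (\<Union>j \<in> underS r i. F j)" if "wo_limit r i" for i
    using lim_all that by blast
  have fac: "\<exists>X \<in> \<X>.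
      lmod_isomorphic R (quotient_module (M\<lparr>carrier := F (wo_rel.suc r {i})\<rparr>) (F i)) X"
    if "i \<in> Field r" "i \<noteq> \<mu>" for i
    using fac_all that by simp
  interpret r: wo_rel r using r by (rule wo_rel.intro)
  have tot: "(i, j) \<in> r \<or> (j, i) \<in> r" if "i \<in> Field r" "j \<in> Field r" for i j
    using r.TOTALS that by blast
  have antisym: "i = j" if "(i, j) \<in> r" "(j, i) \<in> r" for i j
    using r.ANTISYM that by (rule antisymD)
  have trans: "(i, k) \<in> r" if "(i, j) \<in> r" "(j, k) \<in> r" for i j k
    using r.TRANS that by (rule transD)
  have minE: "\<exists>i\<in>Q. \<forall>j\<in>Q. (i, j) \<in> r" if "Q \<subseteq> Field r" "Q \<noteq> {}" for Q
    using that r.minim_in[of Q] r.minim_least[of Q] by blast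
  define S where "S = F ` Field r"
  define s where "s = {(A, B). A \<in> S \<and> B \<in> S \<and> A \<subseteq> B}"
  have Fs: "Field s = S" by (auto simp: s_def Field_def)
  have chain: "A \<subseteq> B \<or> B \<subseteq> A" if "A \<in> S" "B \<in> S" for A B
    using that tot mono unfolding S_def by blast
  have least_index: "\<exists>i\<in>Field r. P (F i) \<and> (\<forall>j\<in>Field r. P (F j) \<longrightarrow> (i, j) \<in> r)"
    if "\<exists>A\<in>S. P A" for P
    using minE[of "{i \<in> Field r. P (F i)}"] that unfolding S_def by blast
  have idx: "underS r k = {} \<or> wo_limit r k \<or> (\<exists>i\<in>underS r k. wo_rel.suc r {i} = k)"
    if "k \<in> Field r" for k
    using that unfolding wo_limit_def by blast
  have s: "Well_order s"
    unfolding Fs order_on_defs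
  proof (intro conjI)
    show "s \<subseteq> S \<times> S" "refl_on S s" by (auto simp: s_def refl_on_def)
    show "trans s" by (auto simp: s_def trans_def)
    show "antisym s" by (auto simp: s_def antisym_def)
    show "total_on S s" using chain by (auto simp: s_def total_on_def)
    show "wf (s - Id)"
    proof (rule wfI_min)
      fix A Q assume A: "(A :: 'b set) \<in> Q"
      show "\<exists>z\<in>Q. \<forall>y. (y, z) \<in> s - Id \<longrightarrow> y \<notin> Q"
      proof (cases "\<exists>A\<in>S. A \<in> Q")
        case True
        then obtain i where i: "i \<in> Field r" "F i \<in> Q"
          "\<And>j. j \<in> Field r \<Longrightarrow> F j \<in> Q \<Longrightarrow> (i, j) \<in> r"
          using least_index[of "\<lambda>A. A \<in> Q"] by blast
        have "B \<notin> Q" if B: "(B, F i) \<in> s - Id" for B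
        proof
          assume "B \<in> Q"
          obtain j where j: "j \<in> Field r" "B = F j" using B by (auto simp: s_def S_def)
          then have "F i \<subseteq> B" using i(3) mono \<open>B \<in> Q\<close> by simp
          then show False using B by (auto simp: s_def)
        qed
        then show ?thesis using i(2) by blast
      next
        case False
        then show ?thesis using A by (auto simp: s_def)
      qed
    qed
  qed
  have underS_s: "underS s A = {B \<in> S. B \<subset> A}" if "A \<in> S" for A
    using that by (auto simp: underS_def s_def)
  have suc_s: "wo_rel.suc s {F i} = F k"
    if k: "k \<in> Field r" and i: "i \<in> underS r k" "wo_rel.suc r {i} = k" and ne: "F i \<noteq> F k" for i k
  proof (rule wo_suc_eqI[OF s])
    have ik: "(i, k) \<in> r" "i \<in> Field r" using i by (auto simp: underS_def Field_def)
    then show "(F i, F k) \<in> s" using mono k by (auto simp: s_def S_def)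
    show "F i \<noteq> F k" by fact
    fix C assume C: "(F i, C) \<in> s" "F i \<noteq> C"
    then obtain j where j: "j \<in> Field r" "C = F j" by (auto simp: s_def S_def)
    have "\<not> (j, i) \<in> r" using C j mono by (auto simp: s_def)
    then have "(i, j) \<in> r" "i \<noteq> j" using tot ik j by auto
    then have "(k, j) \<in> r" using wo_suc_least(3)[OF r] i by metis
    then show "(F k, C) \<in> s" using mono j k by (auto simp: s_def S_def)
  qed
  have "X_filtration R \<X> M s (carrier M) (\<lambda>A. A)"
    unfolding X_filtration_def filtration_def Fs
  proof (intro conjI ballI allI impI)
    show "well_order_on S s" using s Fs by simp
    show mS: "carrier M \<in> S" using mu top by (force simp: S_def)
    fix A assume A: "A \<in> S"
    show "(A, carrier M) \<in> s" using A mS mu_top mono top by (force simp: s_def S_def)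
    show "submodule A R M" using A sub by (auto simp: S_def)
    assume "underS s A = {}"
    then have min: "B = A" if "B \<in> S" "B \<subseteq> A" for B
      using underS_s[OF A] that by blast
    obtain i where i: "i \<in> Field r" "\<And>j. j \<in> Field r \<Longrightarrow> (i, j) \<in> r"
      using minE[of "Field r"] mu by auto
    then have "underS r i = {}" using antisym by (auto simp: underS_def Field_def)
    moreover have "F i = A" using min[of "F i"] A i mono by (auto simp: S_def)
    ultimately show "A = {\<zero>\<^bsub>M\<^esub>}" using zero i by auto
  next
    fix A B assume "(A, B) \<in> s" then show "A \<subseteq> B" by (auto simp: s_def)
  next
    show "carrier M = carrier M" ..
  next
    fix A assume lA: "wo_limit s A"
    then have A: "A \<in> S" by (simp add: wo_limit_def Fs)
    obtain i where i: "i \<in> Field r" "F i = A"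
      and least: "\<And>j. j \<in> Field r \<Longrightarrow> F j = A \<Longrightarrow> (i, j) \<in> r"
      using least_index[of "\<lambda>B. B = A"] A by blast
    have below: "F j \<in> underS s A" if "j \<in> underS r i" for j
    proof -
      have j: "(j, i) \<in> r" "j \<noteq> i" "j \<in> Field r" using that by (auto simp: underS_def Field_def)
      then have "F j \<noteq> A" using least antisym by blast
      then show ?thesis using j mono[OF j(1)] i underS_s[OF A] by (auto simp: S_def)
    qed
    have "underS r i \<noteq> {}"
    proof
      assume "underS r i = {}"
      then have "A = {\<zero>\<^bsub>M\<^esub>}" using zero i by auto
      moreover have "\<zero>\<^bsub>M\<^esub> \<in> B" if "B \<in> S" for B
        using sub that subgroup.one_closed[OF submodule.axioms(1)] by (fastforce simp: S_def)
      ultimately show False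
        using lA underS_s[OF A] unfolding wo_limit_def by blast
    qed
    moreover have False if j: "j \<in> underS r i" "wo_rel.suc r {j} = i" for j
    proof -
      have "F j \<noteq> F i" using below[OF j(1)] i by (auto simp: underS_def)
      then have "wo_rel.suc s {F j} = A" using suc_s[OF i(1) j] i by simp
      then show False using lA below[OF j(1)] by (auto simp: wo_limit_def)
    qed
    ultimately have "wo_limit r i" using idx i by blast
    then have "A = (\<Union>j\<in>underS r i. F j)" using lim i by auto
    then show "A = (\<Union>B\<in>underS s A. B)"
      using below underS_s[OF A] by blast
  next
    fix A assume A: "A \<in> S - {carrier M}"
    have "carrier M \<in> S" using mu top by (force simp: S_def)
    moreover have "\<not> carrier M \<subseteq> A"
      using A mu_top mono top by (force simp: S_def)
    ultimately obtain k where k: "k \<in> Field r" "\<not> F k \<subseteq> A"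
      and least: "\<And>j. j \<in> Field r \<Longrightarrow> \<not> F j \<subseteq> A \<Longrightarrow> (k, j) \<in> r"
      using least_index[of "\<lambda>B. \<not> B \<subseteq> A"] by blast
    obtain l where l: "l \<in> Field r" "A = F l" using A by (auto simp: S_def)
    have "\<not> (k, l) \<in> r" using k l mono by blast
    then have lk: "l \<in> underS r k" using tot k l by (auto simp: underS_def)
    have small: "F j \<subseteq> A" if "j \<in> underS r k" for j
      using that least antisym by (auto simp: underS_def Field_def)
    then have "\<not> wo_limit r k" using lim k by blast
    then obtain i where i: "i \<in> underS r k" "wo_rel.suc r {i} = k"
      using idx[OF k(1)] lk by blast
    have iF: "i \<in> Field r" using i by (auto simp: underS_def Field_def)
    have "(l, i) \<in> r"
    proof (rule ccontr)
      assume "(l, i) \<notin> r"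
      then have "(i, l) \<in> r" "i \<noteq> l" using tot iF l by auto
      then have "(k, l) \<in> r" using wo_suc_least(3)[OF r] i by metis
      then show False using \<open>\<not> (k, l) \<in> r\<close> by simp
    qed
    then have Ai: "F i = A" using mono l small[OF i(1)] by auto
    then have "wo_rel.suc s {A} = F k" using suc_s[OF k(1) i] k by auto
    moreover have "i \<noteq> \<mu>" using Ai A top by auto
    ultimately show "\<exists>X\<in>\<X>. lmod_isomorphic R
        (quotient_module (M\<lparr>carrier := wo_rel.suc s {A}\<rparr>) A) X"
      using fac[OF iF] i Ai by auto
  qed
  then show ?thesis using M unfolding Filt_def by blast
qed

end

theory Submission
  imports Defs
begin

text \<open>A nonzero map from a brick \<open>X\<close> in the semibrick to a filtered module \<open>N\<close> first hits the
  filtration in one of its factors. There it is an isomorphism, so it is injective and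
  its cokernel is filtered again. Let now \<open>f : M \<rightarrow> N\<close> be a homomorphism of filtered modules and
  \<open>(M\<^sub>\<lambda>)\<close> a filtration of \<open>M\<close>. Although \<open>N/f(M\<^sub>\<lambda>)\<close> need not be filtered, it is by transfinite
  induction a direct limit of filtered quotients \<open>N/Q\<close>. A map from the finitely presented brick
  \<open>M\<^sub>\<lambda>\<^sub>+\<^sub>1/M\<^sub>\<lambda>\<close> to \<open>N/f(M\<^sub>\<lambda>)\<close> factors through some \<open>N/Q\<close>, hence is zero or injective. So every
  factor of the chains \<open>f(M\<^sub>\<lambda>)\<close> and \<open>M\<^sub>\<lambda> \<inter> ker f\<close> is zero or isomorphic to \<open>M\<^sub>\<lambda>\<^sub>+\<^sub>1/M\<^sub>\<lambda>\<close>, and discarding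
  repetitions gives filtrations of the image and the kernel.\<close>

section \<open>Submodules and homomorphisms\<close>

context left_module
begin

lemma smult_l_null:
  assumes x: "x \<in> carrier M" shows "\<zero> \<odot>\<^bsub>M\<^esub> x = \<zero>\<^bsub>M\<^esub>"
proof -
  have c: "\<zero> \<odot>\<^bsub>M\<^esub> x \<in> carrier M" using x smult_closed by simp
  have "\<zero> \<odot>\<^bsub>M\<^esub> x \<oplus>\<^bsub>M\<^esub> \<zero> \<odot>\<^bsub>M\<^esub> x = \<zero> \<odot>\<^bsub>M\<^esub> x"
    using smult_l_distr[of \<zero> \<zero> x] x by simp
  then show ?thesis using c by (metis M.add.r_cancel_one')
qed

lemma smult_r_null:
  assumes a: "a \<in> carrier R" shows "a \<odot>\<^bsub>M\<^esub> \<zero>\<^bsub>M\<^esub> = \<zero>\<^bsub>M\<^esub>"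
proof -
  have c: "a \<odot>\<^bsub>M\<^esub> \<zero>\<^bsub>M\<^esub> \<in> carrier M" using a smult_closed by simp
  have "a \<odot>\<^bsub>M\<^esub> \<zero>\<^bsub>M\<^esub> \<oplus>\<^bsub>M\<^esub> a \<odot>\<^bsub>M\<^esub> \<zero>\<^bsub>M\<^esub> = a \<odot>\<^bsub>M\<^esub> \<zero>\<^bsub>M\<^esub>"
    using smult_r_distr[of a "\<zero>\<^bsub>M\<^esub>" "\<zero>\<^bsub>M\<^esub>"] a by simp
  then show ?thesis using c by (metis M.add.r_cancel_one')
qed

lemma smult_minus_one:
  assumes x: "x \<in> carrier M" shows "(\<ominus> \<one>) \<odot>\<^bsub>M\<^esub> x = \<ominus>\<^bsub>M\<^esub> x"
proof -
  have "(\<ominus> \<one>) \<odot>\<^bsub>M\<^esub> x \<oplus>\<^bsub>M\<^esub> x = \<zero>\<^bsub>M\<^esub>"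
    using smult_l_distr[of "\<ominus> \<one>" \<one> x] x smult_one smult_l_null by (simp add: R.l_neg)
  then show ?thesis using x smult_closed by (simp add: M.minus_equality)
qed

lemma submodule_iff:
  "submodule A R M \<longleftrightarrow> A \<subseteq> carrier M \<and> \<zero>\<^bsub>M\<^esub> \<in> A \<and>
    (\<forall>x\<in>A. \<forall>y\<in>A. x \<oplus>\<^bsub>M\<^esub> y \<in> A) \<and> (\<forall>a\<in>carrier R. \<forall>x\<in>A. a \<odot>\<^bsub>M\<^esub> x \<in> A)"
  (is "_ \<longleftrightarrow> ?rhs")
proof
  assume "submodule A R M"
  then interpret submodule A R M .
  show ?rhs using subset one_closed m_closed smult_closed by auto
next
  assume r: ?rhs
  have "\<ominus>\<^bsub>M\<^esub> x \<in> A" if "x \<in> A" for x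
    using that r smult_minus_one[of x] by (metis R.a_inv_closed R.one_closed subsetD)
  then show "submodule A R M"
    using r by unfold_locales (auto simp: a_inv_def[symmetric])
qed

lemma submoduleD:
  assumes "submodule A R M"
  shows "x \<in> A \<Longrightarrow> x \<in> carrier M" "\<zero>\<^bsub>M\<^esub> \<in> A" "x \<in> A \<Longrightarrow> y \<in> A \<Longrightarrow> x \<oplus>\<^bsub>M\<^esub> y \<in> A"
    "a \<in> carrier R \<Longrightarrow> x \<in> A \<Longrightarrow> a \<odot>\<^bsub>M\<^esub> x \<in> A" "x \<in> A \<Longrightarrow> \<ominus>\<^bsub>M\<^esub> x \<in> A"
    "x \<in> A \<Longrightarrow> y \<in> A \<Longrightarrow> x \<ominus>\<^bsub>M\<^esub> y \<in> A"
proof -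
  note * = assms[unfolded submodule_iff]
  show 1: "x \<in> A \<Longrightarrow> x \<in> carrier M" "\<zero>\<^bsub>M\<^esub> \<in> A" "x \<in> A \<Longrightarrow> y \<in> A \<Longrightarrow> x \<oplus>\<^bsub>M\<^esub> y \<in> A"
    "a \<in> carrier R \<Longrightarrow> x \<in> A \<Longrightarrow> a \<odot>\<^bsub>M\<^esub> x \<in> A" for x y a using * by auto
  show 2: "x \<in> A \<Longrightarrow> \<ominus>\<^bsub>M\<^esub> x \<in> A" for x
    using 1 smult_minus_one[of x] by (metis R.a_inv_closed R.one_closed)
  show "x \<in> A \<Longrightarrow> y \<in> A \<Longrightarrow> x \<ominus>\<^bsub>M\<^esub> y \<in> A"
    using 1 2 by (simp add: a_minus_def)
qed

lemma submodule_carrier: "submodule (carrier M) R M"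
  unfolding submodule_iff using smult_closed by auto

lemma submodule_zero: "submodule {\<zero>\<^bsub>M\<^esub>} R M"
  unfolding submodule_iff using smult_r_null by auto

lemma add_diff_cancel:
  "x \<in> carrier M \<Longrightarrow> y \<in> carrier M \<Longrightarrow> y \<oplus>\<^bsub>M\<^esub> (x \<ominus>\<^bsub>M\<^esub> y) = x"
  by (metis M.add.inv_solve_right' M.add.m_comm M.minus_closed M.minus_eq)

lemma diff_eq_zero_iff:
  "x \<in> carrier M \<Longrightarrow> y \<in> carrier M \<Longrightarrow> x \<ominus>\<^bsub>M\<^esub> y = \<zero>\<^bsub>M\<^esub> \<longleftrightarrow> x = y"
  by (simp add: M.add.inv_solve_right' M.minus_eq)

lemma add_eq_diff:
  "x \<in> carrier M \<Longrightarrow> y \<in> carrier M \<Longrightarrow> (y \<oplus>\<^bsub>M\<^esub> x) \<ominus>\<^bsub>M\<^esub> y = x"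
  using add_diff_cancel[of "y \<oplus>\<^bsub>M\<^esub> x" y] by simp

lemma submodule_add_cancel:
  assumes A: "submodule A R M" and x: "x \<in> A" and y: "y \<in> carrier M" and xy: "x \<oplus>\<^bsub>M\<^esub> y \<in> A"
  shows "y \<in> A"
  using submoduleD(6)[OF A xy x] submoduleD(1)[OF A x] y by (simp add: add_eq_diff)

lemma submodule_diff_iff:
  assumes A: "submodule A R M" and x: "x \<in> carrier M" and y: "y \<in> carrier M"
    and xy: "x \<ominus>\<^bsub>M\<^esub> y \<in> A"
  shows "x \<in> A \<longleftrightarrow> y \<in> A"
proof
  have eq: "(x \<ominus>\<^bsub>M\<^esub> y) \<oplus>\<^bsub>M\<^esub> y = x" using add_diff_cancel[OF x y] x y by (simp add: M.a_comm)
  show "y \<in> A \<Longrightarrow> x \<in> A" using submoduleD(3)[OF A xy, of y] eq by simp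
  show "x \<in> A \<Longrightarrow> y \<in> A" using submodule_add_cancel[OF A xy y] eq by simp
qed

lemma submodule_Int: "submodule A R M \<Longrightarrow> submodule B R M \<Longrightarrow> submodule (A \<inter> B) R M"
  unfolding submodule_iff by auto

lemma set_add_iff: "x \<in> A <+>\<^bsub>M\<^esub> B \<longleftrightarrow> (\<exists>a\<in>A. \<exists>b\<in>B. x = a \<oplus>\<^bsub>M\<^esub> b)"
  by (auto simp: set_add_def')

lemma submodule_set_add:
  assumes A: "submodule A R M" and B: "submodule B R M" shows "submodule (A <+>\<^bsub>M\<^esub> B) R M"
  unfolding submodule_iff
proof (intro conjI ballI)
  note DA = submoduleD[OF A] and DB = submoduleD[OF B]
  show "A <+>\<^bsub>M\<^esub> B \<subseteq> carrier M"
    using M.add.m_closed DA(1) DB(1) by (auto simp: set_add_iff)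
  show "\<zero>\<^bsub>M\<^esub> \<in> A <+>\<^bsub>M\<^esub> B"
    using M.l_zero[OF M.zero_closed] DA(2) DB(2) unfolding set_add_iff by metis
  fix x assume "x \<in> A <+>\<^bsub>M\<^esub> B"
  then obtain a b where ab: "a \<in> A" "b \<in> B" "x = a \<oplus>\<^bsub>M\<^esub> b" by (auto simp: set_add_iff)
  note cab = DA(1)[OF ab(1)] DB(1)[OF ab(2)]
  show "r \<odot>\<^bsub>M\<^esub> x \<in> A <+>\<^bsub>M\<^esub> B" if r: "r \<in> carrier R" for r
    using smult_r_distr[OF r cab] DA(4)[OF r ab(1)] DB(4)[OF r ab(2)] ab(3)
    unfolding set_add_iff by blast
  fix y assume "y \<in> A <+>\<^bsub>M\<^esub> B"
  then obtain c d where cd: "c \<in> A" "d \<in> B" "y = c \<oplus>\<^bsub>M\<^esub> d" by (auto simp: set_add_iff)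
  have "x \<oplus>\<^bsub>M\<^esub> y = (a \<oplus>\<^bsub>M\<^esub> c) \<oplus>\<^bsub>M\<^esub> (b \<oplus>\<^bsub>M\<^esub> d)"
    using cab DA(1)[OF cd(1)] DB(1)[OF cd(2)] unfolding ab cd by (simp add: M.a_ac)
  then show "x \<oplus>\<^bsub>M\<^esub> y \<in> A <+>\<^bsub>M\<^esub> B"
    using DA(3)[OF ab(1) cd(1)] DB(3)[OF ab(2) cd(2)] unfolding set_add_iff by blast
qed

lemma left_module_submodule:
  assumes A: "submodule A R M" shows "left_module R (M\<lparr>carrier := A\<rparr>)"
proof -
  note D = submoduleD[OF A]
  have "abelian_group (M\<lparr>carrier := A\<rparr>)"
  proof (rule abelian_groupI)
    fix x assume "x \<in> carrier (M\<lparr>carrier := A\<rparr>)"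
    then show "\<exists>y\<in>carrier (M\<lparr>carrier := A\<rparr>). y \<oplus>\<^bsub>M\<lparr>carrier := A\<rparr>\<^esub> x = \<zero>\<^bsub>M\<lparr>carrier := A\<rparr>\<^esub>"
      using D(5)[of x] M.l_neg[OF D(1), of x] by auto
  qed (use D in \<open>auto simp: M.a_ac\<close>)
  then show ?thesis
    using D smult_l_distr smult_r_distr smult_assoc smult_one
    by (intro left_module.intro left_module_axioms.intro R.ring_axioms) auto
qed

lemma submodule_restrict_iff:
  assumes T: "submodule T R M"
  shows "submodule A R (M\<lparr>carrier := T\<rparr>) \<longleftrightarrow> submodule A R M \<and> A \<subseteq> T"
  unfolding left_module.submodule_iff[OF left_module_submodule[OF T]] submodule_iff
  using submoduleD(1)[OF T] by auto

end

lemma lmod_homD: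
  assumes "f \<in> lmod_hom R M N"
  shows "x \<in> carrier M \<Longrightarrow> f x \<in> carrier N"
    "x \<in> carrier M \<Longrightarrow> y \<in> carrier M \<Longrightarrow> f (x \<oplus>\<^bsub>M\<^esub> y) = f x \<oplus>\<^bsub>N\<^esub> f y"
    "a \<in> carrier R \<Longrightarrow> x \<in> carrier M \<Longrightarrow> f (a \<odot>\<^bsub>M\<^esub> x) = a \<odot>\<^bsub>N\<^esub> f x"
  using assms by (auto simp: lmod_hom_def)

lemma lmod_hom_comp:
  "f \<in> lmod_hom R L M \<Longrightarrow> g \<in> lmod_hom R M N \<Longrightarrow> g \<circ> f \<in> lmod_hom R L N"
  by (simp add: lmod_hom_def Pi_iff)

lemma a_kernel_iff: "x \<in> a_kernel M N f \<longleftrightarrow> x \<in> carrier M \<and> f x = \<zero>\<^bsub>N\<^esub>"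
  by (auto simp: a_kernel_def kernel_def)

locale lmod_hom_pair = M: left_module R M + N: left_module R N
  for R :: "('r, 'k) ring_scheme" and M :: "('r, 'b) module" and N :: "('r, 'c) module" +
  fixes f assumes hom: "f \<in> lmod_hom R M N"
begin

lemmas homD = lmod_homD[OF hom]

lemma hom_zero: "f \<zero>\<^bsub>M\<^esub> = \<zero>\<^bsub>N\<^esub>"
  using homD(2)[of "\<zero>\<^bsub>M\<^esub>" "\<zero>\<^bsub>M\<^esub>"] homD(1)[of "\<zero>\<^bsub>M\<^esub>"] N.M.add.r_cancel_one' by force

lemma hom_minus: "x \<in> carrier M \<Longrightarrow> f (\<ominus>\<^bsub>M\<^esub> x) = \<ominus>\<^bsub>N\<^esub> f x"
  using homD(1,3) M.smult_minus_one N.smult_minus_one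
  by (metis M.R.a_inv_closed M.R.one_closed)

lemma hom_diff:
  "x \<in> carrier M \<Longrightarrow> y \<in> carrier M \<Longrightarrow> f (x \<ominus>\<^bsub>M\<^esub> y) = f x \<ominus>\<^bsub>N\<^esub> f y"
  using homD hom_minus by (simp add: a_minus_def)

lemma hom_eq_iff:
  assumes "x \<in> carrier M" "y \<in> carrier M"
  shows "f x = f y \<longleftrightarrow> f (x \<ominus>\<^bsub>M\<^esub> y) = \<zero>\<^bsub>N\<^esub>"
  using assms homD(1) by (simp add: hom_diff N.diff_eq_zero_iff)

lemma submodule_image:
  assumes "submodule A R M" shows "submodule (f ` A) R N"
  unfolding N.submodule_iff
proof (intro conjI ballI)
  note D = M.submoduleD[OF assms]
  show "f ` A \<subseteq> carrier N" using D homD by auto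
  show "\<zero>\<^bsub>N\<^esub> \<in> f ` A" using D hom_zero by force
  fix x assume "x \<in> f ` A"
  then obtain u where u: "u \<in> A" "x = f u" by auto
  show "a \<odot>\<^bsub>N\<^esub> x \<in> f ` A" if "a \<in> carrier R" for a
    using imageI[OF D(4)[OF that u(1)], of f] homD(3)[OF that D(1)[OF u(1)]] u(2) by simp
  fix y assume "y \<in> f ` A"
  then obtain v where v: "v \<in> A" "y = f v" by auto
  show "x \<oplus>\<^bsub>N\<^esub> y \<in> f ` A"
    using imageI[OF D(3)[OF u(1) v(1)], of f] homD(2)[OF D(1)[OF u(1)] D(1)[OF v(1)]] u v by simp
qed

lemma submodule_vimage:
  assumes "submodule B R N" shows "submodule {x \<in> carrier M. f x \<in> B} R M"
  unfolding M.submodule_iff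
  using N.submoduleD[OF assms] homD hom_zero M.smult_closed by auto

lemma submodule_kernel: "submodule (a_kernel M N f) R M"
  using submodule_vimage[OF N.submodule_zero] by (simp add: a_kernel_def kernel_def)

end

lemma lmod_hom_pairI:
  "left_module R M \<Longrightarrow> left_module R N \<Longrightarrow> f \<in> lmod_hom R M N \<Longrightarrow> lmod_hom_pair R M N f"
  by (simp add: lmod_hom_pair_def lmod_hom_pair_axioms_def)

lemma linear_relation_hom:
  fixes \<rho> :: "'b \<Rightarrow> 'c \<Rightarrow> bool"
  assumes M: "left_module R M" and N: "left_module R N"
    and dom: "\<And>x. x \<in> carrier M \<Longrightarrow> \<exists>y\<in>carrier N. \<rho> x y"
    and add: "\<And>x y x' y'. \<lbrakk>x \<in> carrier M; y \<in> carrier N; x' \<in> carrier M; y' \<in> carrier N;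
      \<rho> x y; \<rho> x' y'\<rbrakk> \<Longrightarrow> \<rho> (x \<oplus>\<^bsub>M\<^esub> x') (y \<oplus>\<^bsub>N\<^esub> y')"
    and smult: "\<And>a x y. \<lbrakk>a \<in> carrier R; x \<in> carrier M; y \<in> carrier N; \<rho> x y\<rbrakk> \<Longrightarrow>
      \<rho> (a \<odot>\<^bsub>M\<^esub> x) (a \<odot>\<^bsub>N\<^esub> y)"
    and zero: "\<And>y. y \<in> carrier N \<Longrightarrow> \<rho> \<zero>\<^bsub>M\<^esub> y \<Longrightarrow> y = \<zero>\<^bsub>N\<^esub>"
  obtains h where "h \<in> lmod_hom R M N"
    "\<And>x y. x \<in> carrier M \<Longrightarrow> y \<in> carrier N \<Longrightarrow> \<rho> x y \<longleftrightarrow> h x = y"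
proof -
  interpret M: left_module R M by fact
  interpret N: left_module R N by fact
  define h where "h x = (SOME y. y \<in> carrier N \<and> \<rho> x y)" for x
  have h: "h x \<in> carrier N" "\<rho> x (h x)" if "x \<in> carrier M" for x
    using someI_ex[of "\<lambda>y. y \<in> carrier N \<and> \<rho> x y"] dom[OF that] by (auto simp: h_def)
  have uniq: "y = y'" if x: "x \<in> carrier M" and y: "y \<in> carrier N" "y' \<in> carrier N"
    and r: "\<rho> x y" "\<rho> x y'" for x y y'
  proof -
    have "\<rho> (\<ominus>\<^bsub>M\<^esub> x) (\<ominus>\<^bsub>N\<^esub> y')"
      using smult[of "\<ominus>\<^bsub>R\<^esub> \<one>\<^bsub>R\<^esub>" x y'] x y r by (simp add: M.smult_minus_one N.smult_minus_one)
    then have "\<rho> \<zero>\<^bsub>M\<^esub> (y \<ominus>\<^bsub>N\<^esub> y')"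
      using add[of x y "\<ominus>\<^bsub>M\<^esub> x" "\<ominus>\<^bsub>N\<^esub> y'"] x y r by (simp add: M.M.r_neg a_minus_def)
    then have "y \<ominus>\<^bsub>N\<^esub> y' = \<zero>\<^bsub>N\<^esub>" using zero y by simp
    then show ?thesis using y by (simp add: N.diff_eq_zero_iff)
  qed
  have "h \<in> lmod_hom R M N"
    unfolding lmod_hom_def
  proof (intro CollectI conjI ballI)
    show "h \<in> carrier M \<rightarrow> carrier N" using h by auto
    fix x assume x: "x \<in> carrier M"
    show "h (x \<oplus>\<^bsub>M\<^esub> y) = h x \<oplus>\<^bsub>N\<^esub> h y" if y: "y \<in> carrier M" for y
      using uniq[of "x \<oplus>\<^bsub>M\<^esub> y"] add h x y by simp
    show "h (a \<odot>\<^bsub>M\<^esub> x) = a \<odot>\<^bsub>N\<^esub> h x" if a: "a \<in> carrier R" for a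
      using uniq[of "a \<odot>\<^bsub>M\<^esub> x"] smult h x a by (simp add: M.smult_closed N.smult_closed)
  qed
  then show thesis using that[of h] h uniq by blast
qed

context left_module
begin

lemma coset_eq_iff:
  assumes A: "submodule A R M" and xy: "x \<in> carrier M" "y \<in> carrier M"
  shows "A +>\<^bsub>M\<^esub> x = A +>\<^bsub>M\<^esub> y \<longleftrightarrow> x \<ominus>\<^bsub>M\<^esub> y \<in> A"
proof -
  have sg: "subgroup A (add_monoid M)" by (rule submodule.axioms(1)[OF A])
  note D = submoduleD[OF A]
  have eq: "(x \<ominus>\<^bsub>M\<^esub> y) \<oplus>\<^bsub>M\<^esub> y = x"
    using add_diff_cancel[OF xy] xy by (simp add: M.a_comm)
  have sub: "A \<subseteq> carrier M" using D(1) by blast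
  show ?thesis
  proof
    assume "A +>\<^bsub>M\<^esub> x = A +>\<^bsub>M\<^esub> y"
    then have "A +>\<^bsub>M\<^esub> (x \<ominus>\<^bsub>M\<^esub> y) = A"
      using M.a_coset_add_inv2[of A x y] xy sub by (simp add: a_minus_def)
    then show "x \<ominus>\<^bsub>M\<^esub> y \<in> A" using M.a_coset_join1[OF _ _ sg] xy by simp
  next
    assume "x \<ominus>\<^bsub>M\<^esub> y \<in> A"
    then have "A +>\<^bsub>M\<^esub> (x \<ominus>\<^bsub>M\<^esub> y) = A" using M.a_coset_join2[OF _ sg] xy by simp
    then show "A +>\<^bsub>M\<^esub> x = A +>\<^bsub>M\<^esub> y"
      using M.a_coset_add_inv1[of A x y] xy sub by (simp add: a_minus_def)
  qed
qed

lemma mem_coset_iff: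
  assumes A: "submodule A R M" and x: "x \<in> carrier M"
  shows "y \<in> A +>\<^bsub>M\<^esub> x \<longleftrightarrow> y \<in> carrier M \<and> y \<ominus>\<^bsub>M\<^esub> x \<in> A"
proof
  assume "y \<in> A +>\<^bsub>M\<^esub> x"
  then obtain h where h: "h \<in> A" "y = h \<oplus>\<^bsub>M\<^esub> x" by (auto simp: a_r_coset_def')
  then show "y \<in> carrier M \<and> y \<ominus>\<^bsub>M\<^esub> x \<in> A"
    using submoduleD(1)[OF A h(1)] x add_eq_diff[of h x] by (simp add: M.a_comm)
next
  assume y: "y \<in> carrier M \<and> y \<ominus>\<^bsub>M\<^esub> x \<in> A"
  then have "y = (y \<ominus>\<^bsub>M\<^esub> x) \<oplus>\<^bsub>M\<^esub> x"
    using add_diff_cancel[of y x] x by (simp add: M.a_comm)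
  then show "y \<in> A +>\<^bsub>M\<^esub> x" using y by (auto simp: a_r_coset_def')
qed

lemma coset_add:
  assumes A: "submodule A R M" and xy: "x \<in> carrier M" "y \<in> carrier M"
  shows "(A +>\<^bsub>M\<^esub> x) <+>\<^bsub>M\<^esub> (A +>\<^bsub>M\<^esub> y) = A +>\<^bsub>M\<^esub> (x \<oplus>\<^bsub>M\<^esub> y)"
  using abelian_subgroup.a_rcos_sum[OF abelian_subgroupI3[OF additive_subgroupI] xy]
    submodule.axioms(1)[OF A] M.abelian_group_axioms by blast

lemma coset_smult:
  assumes A: "submodule A R M" and x: "x \<in> carrier M" and a: "a \<in> carrier R"
  shows "(\<Union>y\<in>A +>\<^bsub>M\<^esub> x. A +>\<^bsub>M\<^esub> (a \<odot>\<^bsub>M\<^esub> y)) = A +>\<^bsub>M\<^esub> (a \<odot>\<^bsub>M\<^esub> x)"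
proof -
  have *: "A +>\<^bsub>M\<^esub> (a \<odot>\<^bsub>M\<^esub> y) = A +>\<^bsub>M\<^esub> (a \<odot>\<^bsub>M\<^esub> x)" if "y \<in> A +>\<^bsub>M\<^esub> x" for y
  proof -
    have y: "y \<in> carrier M" "y \<ominus>\<^bsub>M\<^esub> x \<in> A" using that mem_coset_iff[OF A x] by auto
    have "a \<odot>\<^bsub>M\<^esub> y = a \<odot>\<^bsub>M\<^esub> x \<oplus>\<^bsub>M\<^esub> a \<odot>\<^bsub>M\<^esub> (y \<ominus>\<^bsub>M\<^esub> x)"
      using smult_r_distr[OF a x, of "y \<ominus>\<^bsub>M\<^esub> x"] add_diff_cancel[OF y(1) x] x y by simp
    then have "a \<odot>\<^bsub>M\<^esub> y \<ominus>\<^bsub>M\<^esub> a \<odot>\<^bsub>M\<^esub> x = a \<odot>\<^bsub>M\<^esub> (y \<ominus>\<^bsub>M\<^esub> x)"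
      using add_eq_diff smult_closed a x y by simp
    then show ?thesis
      using coset_eq_iff[OF A] submoduleD(4)[OF A a y(2)] smult_closed a x y by simp
  qed
  moreover have "x \<in> A +>\<^bsub>M\<^esub> x"
    using mem_coset_iff[OF A x] x submoduleD(2)[OF A] diff_eq_zero_iff[OF x x] by simp
  ultimately show ?thesis by blast
qed

end

lemma quotient_module_simps:
  "carrier (quotient_module M A) = (\<lambda>x. A +>\<^bsub>M\<^esub> x) ` carrier M"
  "zero (quotient_module M A) = A"
  "add (quotient_module M A) C D = C <+>\<^bsub>M\<^esub> D"
  "smult (quotient_module M A) a C = (\<Union>x\<in>C. A +>\<^bsub>M\<^esub> (a \<odot>\<^bsub>M\<^esub> x))"
  by (auto simp: quotient_module_def A_RCOSETS_def')

lemma quotient_isomorphic_iff: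
  assumes M: "left_module R M" and X: "left_module R X" and A: "submodule A R M"
  shows "lmod_isomorphic R (quotient_module M A) X \<longleftrightarrow>
    (\<exists>h\<in>lmod_hom R M X. h ` carrier M = carrier X \<and> {x \<in> carrier M. h x = \<zero>\<^bsub>X\<^esub>} = A)"
proof -
  interpret M: left_module R M by fact
  interpret X: left_module R X by fact
  let ?Q = "quotient_module M A" and ?q = "\<lambda>x. A +>\<^bsub>M\<^esub> x"
  note Qs = quotient_module_simps[of M A]
  have q_add: "?q (x \<oplus>\<^bsub>M\<^esub> y) = add ?Q (?q x) (?q y)"
    if "x \<in> carrier M" "y \<in> carrier M" for x y
    using M.coset_add[OF A that] by (simp add: Qs)
  have q_smult: "?q (a \<odot>\<^bsub>M\<^esub> x) = smult ?Q a (?q x)"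
    if "a \<in> carrier R" "x \<in> carrier M" for a x
    using M.coset_smult[OF A that(2,1)] by (simp add: Qs)
  have q_hom: "?q \<in> lmod_hom R M ?Q"
    using q_add q_smult by (auto simp: lmod_hom_def Qs)
  show ?thesis
  proof
    assume "lmod_isomorphic R ?Q X"
    then obtain \<theta> where \<theta>: "\<theta> \<in> lmod_hom R ?Q X" "bij_betw \<theta> (carrier ?Q) (carrier X)"
      by (auto simp: lmod_isomorphic_def)
    have hom: "\<theta> \<circ> ?q \<in> lmod_hom R M X" by (rule lmod_hom_comp[OF q_hom \<theta>(1)])
    interpret h: lmod_hom_pair R M X "\<theta> \<circ> ?q" by (rule lmod_hom_pairI[OF M X hom])
    have "(\<theta> \<circ> ?q) ` carrier M = carrier X"
      using bij_betw_imp_surj_on[OF \<theta>(2)] by (simp add: Qs image_image)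
    moreover have "(\<theta> \<circ> ?q) x = \<zero>\<^bsub>X\<^esub> \<longleftrightarrow> x \<in> A" if x: "x \<in> carrier M" for x
    proof -
      have "(\<theta> \<circ> ?q) x = \<zero>\<^bsub>X\<^esub> \<longleftrightarrow> \<theta> (?q x) = \<theta> (?q \<zero>\<^bsub>M\<^esub>)" using h.hom_zero by simp
      also have "\<dots> \<longleftrightarrow> ?q x = ?q \<zero>\<^bsub>M\<^esub>"
        using inj_onD[OF bij_betw_imp_inj_on[OF \<theta>(2)]] x by (auto simp: Qs)
      also have "\<dots> \<longleftrightarrow> x \<in> A"
        using M.coset_eq_iff[OF A x, of "\<zero>\<^bsub>M\<^esub>"] M.add_diff_cancel[OF x, of "\<zero>\<^bsub>M\<^esub>"] x by simp
      finally show ?thesis .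
    qed
    then have "{x \<in> carrier M. (\<theta> \<circ> ?q) x = \<zero>\<^bsub>X\<^esub>} = A"
      using M.submoduleD(1)[OF A] by blast
    ultimately show "\<exists>h\<in>lmod_hom R M X. h ` carrier M = carrier X \<and>
      {x \<in> carrier M. h x = \<zero>\<^bsub>X\<^esub>} = A" using hom by blast
  next
    assume "\<exists>h\<in>lmod_hom R M X. h ` carrier M = carrier X \<and> {x \<in> carrier M. h x = \<zero>\<^bsub>X\<^esub>} = A"
    then obtain h where h: "h \<in> lmod_hom R M X" "h ` carrier M = carrier X"
      "{x \<in> carrier M. h x = \<zero>\<^bsub>X\<^esub>} = A" by blast
    interpret h: lmod_hom_pair R M X h by (rule lmod_hom_pairI[OF M X h(1)])
    define \<theta> where "\<theta> C = h (SOME x. x \<in> C)" for C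
    have h_eq: "h x = h y \<longleftrightarrow> ?q x = ?q y" if "x \<in> carrier M" "y \<in> carrier M" for x y
      using h.hom_eq_iff[OF that] M.coset_eq_iff[OF A that] h(3) that by auto
    have \<theta>q: "\<theta> (?q x) = h x" if x: "x \<in> carrier M" for x
    proof -
      have "x \<in> ?q x"
        using M.mem_coset_iff[OF A x] x M.submoduleD(2)[OF A] M.diff_eq_zero_iff[OF x x] by simp
      then have "(SOME y. y \<in> ?q x) \<in> ?q x" by (rule someI)
      then show ?thesis
        using h_eq[OF _ x] M.coset_eq_iff[OF A _ x] M.mem_coset_iff[OF A x]
        by (simp add: \<theta>_def)
    qed
    have "\<theta> \<in> lmod_hom R ?Q X"
      unfolding lmod_hom_def
    proof (intro CollectI conjI ballI)
      show "\<theta> \<in> carrier ?Q \<rightarrow> carrier X" using \<theta>q h.homD(1) by (auto simp: Qs(1))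
      fix C assume "C \<in> carrier ?Q"
      then obtain x where x: "x \<in> carrier M" "C = ?q x" by (auto simp: Qs(1))
      show "\<theta> (smult ?Q a C) = a \<odot>\<^bsub>X\<^esub> \<theta> C" if a: "a \<in> carrier R" for a
        using q_smult[OF a x(1)] \<theta>q x h.homD(3)[OF a x(1)] M.smult_closed[OF a x(1)] by metis
      fix D assume "D \<in> carrier ?Q"
      then obtain y where y: "y \<in> carrier M" "D = ?q y" by (auto simp: Qs(1))
      show "\<theta> (add ?Q C D) = \<theta> C \<oplus>\<^bsub>X\<^esub> \<theta> D"
        using q_add[OF x(1) y(1)] \<theta>q x y h.homD(2)[OF x(1) y(1)] M.M.a_closed[OF x(1) y(1)]
        by metis
    qed
    moreover have "bij_betw \<theta> (carrier ?Q) (carrier X)"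
      unfolding bij_betw_def
    proof
      show "inj_on \<theta> (carrier ?Q)" using h_eq \<theta>q by (auto simp: inj_on_def Qs(1))
      show "\<theta> ` carrier ?Q = carrier X" using \<theta>q h(2) by (simp add: Qs(1) image_image)
    qed
    ultimately show "lmod_isomorphic R ?Q X" by (auto simp: lmod_isomorphic_def)
  qed
qed

section \<open>Free modules of finite rank\<close>

definition unit_vec :: "('r, 'k) ring_scheme \<Rightarrow> nat \<Rightarrow> nat \<Rightarrow> nat \<Rightarrow> 'r" where
  "unit_vec R n i = (\<lambda>j\<in>{..<n}. if j = i then \<one>\<^bsub>R\<^esub> else \<zero>\<^bsub>R\<^esub>)"

lemma free_module_simps:
  "carrier (free_module R n) = {..<n} \<rightarrow>\<^sub>E carrier R"
  "zero (free_module R n) = (\<lambda>i\<in>{..<n}. \<zero>\<^bsub>R\<^esub>)"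
  "add (free_module R n) v w = (\<lambda>i\<in>{..<n}. v i \<oplus>\<^bsub>R\<^esub> w i)"
  "smult (free_module R n) a v = (\<lambda>i\<in>{..<n}. a \<otimes>\<^bsub>R\<^esub> v i)"
  by (simp_all add: free_module_def)

lemma free_module_left_module:
  assumes "ring R" shows "left_module R (free_module R n)"
proof -
  interpret ring R by fact
  let ?F = "free_module R n"
  have mem: "v i \<in> carrier R" if "v \<in> carrier ?F" "i < n" for v i
    using that by (auto simp: free_module_simps)
  have eqI: "v = w" if "v \<in> carrier ?F" "w \<in> carrier ?F" "\<And>i. i < n \<Longrightarrow> v i = w i" for v w
    using that by (auto simp: free_module_simps intro: PiE_ext)
  have cl: "v \<in> carrier ?F \<Longrightarrow> w \<in> carrier ?F \<Longrightarrow> v \<oplus>\<^bsub>?F\<^esub> w \<in> carrier ?F"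
    "a \<in> carrier R \<Longrightarrow> v \<in> carrier ?F \<Longrightarrow> a \<odot>\<^bsub>?F\<^esub> v \<in> carrier ?F"
    "\<zero>\<^bsub>?F\<^esub> \<in> carrier ?F" for v w a
    by (auto simp: free_module_simps)
  have ap: "(v \<oplus>\<^bsub>?F\<^esub> w) i = v i \<oplus>\<^bsub>R\<^esub> w i" "(a \<odot>\<^bsub>?F\<^esub> v) i = a \<otimes>\<^bsub>R\<^esub> v i" "\<zero>\<^bsub>?F\<^esub> i = \<zero>\<^bsub>R\<^esub>"
    if "i < n" for v w a i
    using that by (auto simp: free_module_simps)
  have "abelian_group ?F"
  proof (rule abelian_groupI)
    fix v assume v: "v \<in> carrier ?F"
    have "(\<lambda>i\<in>{..<n}. \<ominus>\<^bsub>R\<^esub> v i) \<in> carrier ?F" using mem[OF v] by (auto simp: free_module_simps)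
    moreover have "(\<lambda>i\<in>{..<n}. \<ominus>\<^bsub>R\<^esub> v i) \<oplus>\<^bsub>?F\<^esub> v = \<zero>\<^bsub>?F\<^esub>"
      using mem[OF v] by (auto simp: free_module_simps l_neg)
    ultimately show "\<exists>w\<in>carrier ?F. w \<oplus>\<^bsub>?F\<^esub> v = \<zero>\<^bsub>?F\<^esub>" by blast
  next
    fix u v w assume "u \<in> carrier ?F" "v \<in> carrier ?F" "w \<in> carrier ?F"
    then show "u \<oplus>\<^bsub>?F\<^esub> v \<oplus>\<^bsub>?F\<^esub> w = u \<oplus>\<^bsub>?F\<^esub> (v \<oplus>\<^bsub>?F\<^esub> w)"
      by (intro eqI) (simp_all add: cl ap mem a_assoc)
  next
    show "v \<oplus>\<^bsub>?F\<^esub> w = w \<oplus>\<^bsub>?F\<^esub> v" if "v \<in> carrier ?F" "w \<in> carrier ?F" for v w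
      using that by (intro eqI) (simp_all add: cl ap mem a_comm)
    show "\<zero>\<^bsub>?F\<^esub> \<oplus>\<^bsub>?F\<^esub> v = v" if "v \<in> carrier ?F" for v
      using that by (intro eqI) (simp_all add: cl ap mem)
  qed (rule cl(1,3); assumption)+
  moreover have "(a \<oplus>\<^bsub>R\<^esub> b) \<odot>\<^bsub>?F\<^esub> v = a \<odot>\<^bsub>?F\<^esub> v \<oplus>\<^bsub>?F\<^esub> b \<odot>\<^bsub>?F\<^esub> v"
    "(a \<otimes>\<^bsub>R\<^esub> b) \<odot>\<^bsub>?F\<^esub> v = a \<odot>\<^bsub>?F\<^esub> (b \<odot>\<^bsub>?F\<^esub> v)"
    if "a \<in> carrier R" "b \<in> carrier R" "v \<in> carrier ?F" for a b v
    using that by (auto intro!: eqI cl simp: ap mem l_distr m_assoc)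
  moreover have "a \<odot>\<^bsub>?F\<^esub> (v \<oplus>\<^bsub>?F\<^esub> w) = a \<odot>\<^bsub>?F\<^esub> v \<oplus>\<^bsub>?F\<^esub> a \<odot>\<^bsub>?F\<^esub> w"
    if "a \<in> carrier R" "v \<in> carrier ?F" "w \<in> carrier ?F" for a v w
    using that by (auto intro!: eqI cl simp: ap mem r_distr)
  moreover have "\<one>\<^bsub>R\<^esub> \<odot>\<^bsub>?F\<^esub> v = v" if "v \<in> carrier ?F" for v
    using that by (auto intro!: eqI cl simp: ap mem)
  ultimately show ?thesis
    using cl(2) ring_axioms by (simp add: left_module_def left_module_axioms_def)
qed

context left_module
begin

lemma unit_vec_closed: "unit_vec R n i \<in> carrier (free_module R n)"
  by (auto simp: unit_vec_def free_module_simps)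

lemma submodule_finsum:
  assumes S: "submodule S R M" and "finite I" "\<And>i. i \<in> I \<Longrightarrow> g i \<in> S"
  shows "finsum M g I \<in> S"
  using assms(2,3)
proof (induction I rule: finite_induct)
  case empty
  then show ?case using submoduleD(2)[OF S] by simp
next
  case (insert i I)
  then have "g \<in> I \<rightarrow> carrier M" "g i \<in> carrier M" using submoduleD(1)[OF S] by auto
  then show ?case using insert submoduleD(3)[OF S] by simp
qed

lemma hom_free_expand:
  assumes \<phi>: "\<phi> \<in> lmod_hom R (free_module R n) M" and v: "v \<in> carrier (free_module R n)"
  shows "\<phi> v = (\<Oplus>\<^bsub>M\<^esub>i\<in>{..<n}. v i \<odot>\<^bsub>M\<^esub> \<phi> (unit_vec R n i))"
proof -
  let ?F = "free_module R n"
  interpret \<phi>: lmod_hom_pair R ?F M \<phi>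
    by (rule lmod_hom_pairI[OF free_module_left_module left_module_axioms \<phi>]) (rule R.ring_axioms)
  define t where "t k = (\<lambda>j\<in>{..<n}. if j < k then v j else \<zero>)" for k
  have vR: "v i \<in> carrier R" if "i < n" for i using v that by (auto simp: free_module_simps)
  have tF: "t k \<in> carrier ?F" for k using vR by (auto simp: t_def free_module_simps)
  have cl: "v i \<odot>\<^bsub>M\<^esub> \<phi> (unit_vec R n i) \<in> carrier M" if "i < n" for i
    using smult_closed[OF vR[OF that] \<phi>.homD(1)[OF unit_vec_closed]] .
  have "k \<le> n \<Longrightarrow> \<phi> (t k) = (\<Oplus>\<^bsub>M\<^esub>i\<in>{..<k}. v i \<odot>\<^bsub>M\<^esub> \<phi> (unit_vec R n i))" for k
  proof (induction k)
    case 0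
    have "t 0 = \<zero>\<^bsub>?F\<^esub>" by (auto simp: t_def free_module_simps)
    then show ?case using \<phi>.hom_zero by simp
  next
    case (Suc k)
    have "t (Suc k) = v k \<odot>\<^bsub>?F\<^esub> unit_vec R n k \<oplus>\<^bsub>?F\<^esub> t k"
      using Suc.prems vR by (auto simp: t_def free_module_simps unit_vec_def fun_eq_iff less_Suc_eq)
    then have "\<phi> (t (Suc k)) = v k \<odot>\<^bsub>M\<^esub> \<phi> (unit_vec R n k) \<oplus>\<^bsub>M\<^esub> \<phi> (t k)"
      using \<phi>.homD(2)[OF \<phi>.M.smult_closed[OF vR unit_vec_closed] tF] Suc.prems
        \<phi>.homD(3)[OF vR unit_vec_closed] by simp
    moreover have "(\<lambda>i. v i \<odot>\<^bsub>M\<^esub> \<phi> (unit_vec R n i)) \<in> {..<k} \<rightarrow> carrier M"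
      using cl Suc.prems by auto
    ultimately show ?case using Suc cl[of k] by (simp add: lessThan_Suc)
  qed
  from this[of n] show ?thesis
    using v by (auto simp: t_def free_module_simps PiE_iff extensional_restrict cong: restrict_cong)
qed

lemma hom_free_eqI:
  assumes "\<phi> \<in> lmod_hom R (free_module R n) M" "\<psi> \<in> lmod_hom R (free_module R n) M"
    and "\<And>i. i < n \<Longrightarrow> \<phi> (unit_vec R n i) = \<psi> (unit_vec R n i)"
    and v: "v \<in> carrier (free_module R n)"
  shows "\<phi> v = \<psi> v"
proof -
  have "v i \<odot>\<^bsub>M\<^esub> \<psi> (unit_vec R n i) \<in> carrier M" if "i < n" for i
    using lmod_homD(1)[OF assms(2) unit_vec_closed] v that
    by (intro smult_closed) (auto simp: free_module_simps)
  then show ?thesis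
    unfolding hom_free_expand[OF assms(1) v] hom_free_expand[OF assms(2) v]
    by (intro M.finsum_cong') (auto simp: assms(3))
qed

lemma hom_free_range:
  assumes "\<phi> \<in> lmod_hom R (free_module R n) M" and S: "submodule S R M"
    and "\<And>i. i < n \<Longrightarrow> \<phi> (unit_vec R n i) \<in> S" and v: "v \<in> carrier (free_module R n)"
  shows "\<phi> v \<in> S"
  unfolding hom_free_expand[OF assms(1) v]
  using assms v by (intro submodule_finsum[OF S]) (auto simp: free_module_simps intro: submoduleD(4)[OF S])

lemma free_module_hom_exists:
  assumes y: "\<And>i. i < n \<Longrightarrow> y i \<in> carrier M"
  obtains \<phi> where "\<phi> \<in> lmod_hom R (free_module R n) M" "\<And>i. i < n \<Longrightarrow> \<phi> (unit_vec R n i) = y i"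
proof -
  let ?F = "free_module R n"
  define \<phi> where "\<phi> v = (\<Oplus>\<^bsub>M\<^esub>i\<in>{..<n}. v i \<odot>\<^bsub>M\<^esub> y i)" for v
  have vR: "v i \<in> carrier R" if "v \<in> carrier ?F" "i < n" for v i
    using that by (auto simp: free_module_simps)
  have cl: "v i \<odot>\<^bsub>M\<^esub> y i \<in> carrier M" if "v \<in> carrier ?F" "i < n" for v i
    using smult_closed vR y that by simp
  have smult_sum: "a \<odot>\<^bsub>M\<^esub> finsum M g {..<k} = (\<Oplus>\<^bsub>M\<^esub>i\<in>{..<k}. a \<odot>\<^bsub>M\<^esub> g i)"
    if "a \<in> carrier R" "g \<in> {..<k} \<rightarrow> carrier M" for a g and k :: nat
    using that(2)
  proof (induction k)
    case (Suc k)
    have g: "g \<in> {..<k} \<rightarrow> carrier M" "g k \<in> carrier M" using Suc.prems by auto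
    then have "(\<lambda>i. a \<odot>\<^bsub>M\<^esub> g i) \<in> {..<k} \<rightarrow> carrier M" using smult_closed that(1) by auto
    then show ?case
      using g Suc.IH smult_closed that(1) by (simp add: lessThan_Suc smult_r_distr)
  qed (simp add: smult_r_null that(1))
  have "\<phi> \<in> lmod_hom R ?F M"
    unfolding lmod_hom_def
  proof (intro CollectI conjI ballI)
    show "\<phi> \<in> carrier ?F \<rightarrow> carrier M" using cl by (auto simp: \<phi>_def intro!: M.finsum_closed)
    fix v assume v: "v \<in> carrier ?F"
    show "\<phi> (a \<odot>\<^bsub>?F\<^esub> v) = a \<odot>\<^bsub>M\<^esub> \<phi> v" if a: "a \<in> carrier R" for a
      unfolding \<phi>_def
      using cl[OF v] smult_closed[OF a cl[OF v]] smult_assoc[OF a vR[OF v] y] a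
      by (subst smult_sum) (auto intro!: M.finsum_cong' simp: free_module_simps)
    fix w assume w: "w \<in> carrier ?F"
    have "\<phi> (v \<oplus>\<^bsub>?F\<^esub> w) = (\<Oplus>\<^bsub>M\<^esub>i\<in>{..<n}. v i \<odot>\<^bsub>M\<^esub> y i \<oplus>\<^bsub>M\<^esub> w i \<odot>\<^bsub>M\<^esub> y i)"
      unfolding \<phi>_def using cl[OF v] cl[OF w] smult_l_distr[OF vR[OF v] vR[OF w] y]
      by (intro M.finsum_cong') (auto simp: free_module_simps)
    also have "\<dots> = \<phi> v \<oplus>\<^bsub>M\<^esub> \<phi> w"
      unfolding \<phi>_def using cl[OF v] cl[OF w] by (intro M.finsum_addf) auto
    finally show "\<phi> (v \<oplus>\<^bsub>?F\<^esub> w) = \<phi> v \<oplus>\<^bsub>M\<^esub> \<phi> w" .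
  qed
  moreover have "\<phi> (unit_vec R n i) = y i" if i: "i < n" for i
  proof -
    have "\<phi> (unit_vec R n i) = (\<Oplus>\<^bsub>M\<^esub>j\<in>{..<n}. if i = j then y j else \<zero>\<^bsub>M\<^esub>)"
      unfolding \<phi>_def using y smult_one smult_l_null
      by (intro M.finsum_cong') (auto simp: unit_vec_def)
    then show ?thesis using M.finsum_singleton[of i "{..<n}" y] i y by auto
  qed
  ultimately show thesis by (rule that)
qed

end

section \<open>Filtering chains of submodules\<close>

locale semibrick_context =
  fixes R :: "('r, 'k) ring_scheme" and \<X> :: "('r, 'x) module set"
  assumes ring: "ring R" and semibrick: "semibrick R \<X>"
begin

lemma brick_left_module: "X \<in> \<X> \<Longrightarrow> left_module R X"
  using semibrick by (auto simp: semibrick_def brick_def finitely_presented_def)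

lemma brick_nontrivial:
  assumes X: "X \<in> \<X>" shows "\<exists>x\<in>carrier X. x \<noteq> \<zero>\<^bsub>X\<^esub>"
proof (rule ccontr)
  assume n: "\<not> ?thesis"
  have "division_ring (endo_ring R X)"
    using semibrick X by (auto simp: semibrick_def brick_def)
  then have "\<one>\<^bsub>endo_ring R X\<^esub> \<noteq> \<zero>\<^bsub>endo_ring R X\<^esub>" by (rule division_ring.one_not_zero)
  then show False using n by (auto simp: endo_ring_def restrict_def fun_eq_iff split: if_splits)
qed

definition fstep :: "('r, 'b) module \<Rightarrow> 'b set \<Rightarrow> 'b set \<Rightarrow> bool" where
  "fstep M A B \<longleftrightarrow> (\<exists>X\<in>\<X>. \<exists>h\<in>lmod_hom R (M\<lparr>carrier := B\<rparr>) X.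
    h ` B = carrier X \<and> {x \<in> B. h x = \<zero>\<^bsub>X\<^esub>} = A)"

lemma fstepE:
  assumes "fstep M A B"
  obtains X h where "X \<in> \<X>" "h \<in> lmod_hom R (M\<lparr>carrier := B\<rparr>) X" "h ` B = carrier X"
    "{x \<in> B. h x = \<zero>\<^bsub>X\<^esub>} = A"
  using assms by (auto simp: fstep_def)

lemma fstep_subset: "fstep M A B \<Longrightarrow> A \<subset> B"
proof (erule fstepE)
  fix X h
  assume h: "X \<in> \<X>" "h ` B = carrier X" "{x \<in> B. h x = \<zero>\<^bsub>X\<^esub>} = A"
  obtain x where "x \<in> carrier X" "x \<noteq> \<zero>\<^bsub>X\<^esub>" using brick_nontrivial[OF h(1)] by blast
  then show "A \<subset> B" using h(2,3) by force
qed

lemma fstep_carrier_update [simp]: "fstep (M\<lparr>carrier := T\<rparr>) A B = fstep M A B"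
  by (simp add: fstep_def)

lemma fstep_iff_quotient:
  assumes M: "left_module R M" and B: "submodule B R M" and A: "submodule A R M" "A \<subseteq> B"
  shows "fstep M A B \<longleftrightarrow>
    (\<exists>X\<in>\<X>. lmod_isomorphic R (quotient_module (M\<lparr>carrier := B\<rparr>) A) X)"
proof -
  interpret M: left_module R M by fact
  have "submodule A R (M\<lparr>carrier := B\<rparr>)" using M.submodule_restrict_iff[OF B] A by simp
  then show ?thesis
    using quotient_isomorphic_iff[OF M.left_module_submodule[OF B] brick_left_module]
    by (simp add: fstep_def cong: bex_cong)
qed

text \<open>A linear relation between \<open>B\<close> and \<open>B'\<close>, total on both sides and matching \<open>A\<close> with \<open>A'\<close>,
  induces an isomorphism between the quotients.\<close>

lemma fstep_transfer:
  assumes M: "left_module R M" and N: "left_module R N"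
    and B: "submodule B R M" and B': "submodule B' R N" and A': "A' \<subseteq> B'"
    and st: "fstep M A B"
    and cov: "\<And>y. y \<in> B' \<Longrightarrow> \<exists>b\<in>B. \<rho> b y" "\<And>b. b \<in> B \<Longrightarrow> \<exists>y\<in>B'. \<rho> b y"
    and add: "\<And>b c y z. \<lbrakk>b \<in> B; c \<in> B; y \<in> B'; z \<in> B'; \<rho> b y; \<rho> c z\<rbrakk> \<Longrightarrow>
      \<rho> (b \<oplus>\<^bsub>M\<^esub> c) (y \<oplus>\<^bsub>N\<^esub> z)"
    and smult: "\<And>a b y. \<lbrakk>a \<in> carrier R; b \<in> B; y \<in> B'; \<rho> b y\<rbrakk> \<Longrightarrow>
      \<rho> (a \<odot>\<^bsub>M\<^esub> b) (a \<odot>\<^bsub>N\<^esub> y)"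
    and iff: "\<And>b y. \<lbrakk>b \<in> B; y \<in> B'; \<rho> b y\<rbrakk> \<Longrightarrow> b \<in> A \<longleftrightarrow> y \<in> A'"
    and zero: "\<zero>\<^bsub>N\<^esub> \<in> A'"
  shows "fstep N A' B'"
proof -
  interpret M: left_module R M by fact
  interpret N: left_module R N by fact
  obtain X h where X: "X \<in> \<X>" and h: "h \<in> lmod_hom R (M\<lparr>carrier := B\<rparr>) X" "h ` B = carrier X"
    "{x \<in> B. h x = \<zero>\<^bsub>X\<^esub>} = A" using st by (rule fstepE)
  note hD = lmod_homD[OF h(1), simplified]
  note BD = M.submoduleD[OF B]
  define \<sigma> where "\<sigma> y x \<longleftrightarrow> (\<exists>b\<in>B. \<rho> b y \<and> h b = x)" for y x
  obtain k where k: "k \<in> lmod_hom R (N\<lparr>carrier := B'\<rparr>) X"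
    "\<And>y x. y \<in> B' \<Longrightarrow> x \<in> carrier X \<Longrightarrow> \<sigma> y x \<longleftrightarrow> k y = x"
  proof (rule linear_relation_hom[OF N.left_module_submodule[OF B'] brick_left_module[OF X], of \<sigma>])
    fix y assume "y \<in> carrier (N\<lparr>carrier := B'\<rparr>)"
    then show "\<exists>x\<in>carrier X. \<sigma> y x" using cov(1) hD(1) by (fastforce simp: \<sigma>_def)
  next
    fix y x y' x' assume *: "y \<in> carrier (N\<lparr>carrier := B'\<rparr>)" "y' \<in> carrier (N\<lparr>carrier := B'\<rparr>)"
      "\<sigma> y x" "\<sigma> y' x'"
    then obtain b b' where "b \<in> B" "\<rho> b y" "h b = x" "b' \<in> B" "\<rho> b' y'" "h b' = x'"
      by (auto simp: \<sigma>_def)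
    then show "\<sigma> (y \<oplus>\<^bsub>N\<lparr>carrier := B'\<rparr>\<^esub> y') (x \<oplus>\<^bsub>X\<^esub> x')"
      using add[of b b' y y'] hD(2)[of b b'] BD(3)[of b b'] * by (auto simp: \<sigma>_def)
  next
    fix a y x assume *: "a \<in> carrier R" "y \<in> carrier (N\<lparr>carrier := B'\<rparr>)" "\<sigma> y x"
    then obtain b where "b \<in> B" "\<rho> b y" "h b = x" by (auto simp: \<sigma>_def)
    then show "\<sigma> (a \<odot>\<^bsub>N\<lparr>carrier := B'\<rparr>\<^esub> y) (a \<odot>\<^bsub>X\<^esub> x)"
      using smult[of a b y] hD(3)[of a b] BD(4)[of a b] * by (auto simp: \<sigma>_def)
  next
    fix x assume "\<sigma> \<zero>\<^bsub>N\<lparr>carrier := B'\<rparr>\<^esub> x"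
    then obtain b where "b \<in> B" "\<rho> b \<zero>\<^bsub>N\<^esub>" "h b = x" by (auto simp: \<sigma>_def)
    then show "x = \<zero>\<^bsub>X\<^esub>" using iff[of b "\<zero>\<^bsub>N\<^esub>"] zero A' h(3) by auto
  qed simp
  have kb: "k y = h b" if "b \<in> B" "y \<in> B'" "\<rho> b y" for b y
    using k(2)[of y "h b"] that hD(1) by (auto simp: \<sigma>_def)
  have "k ` B' = carrier X"
  proof
    show "k ` B' \<subseteq> carrier X" using lmod_homD(1)[OF k(1)] by auto
    show "carrier X \<subseteq> k ` B'" using kb cov(2) h(2) by (metis (no_types, lifting) imageE image_eqI subsetI)
  qed
  moreover have "{y \<in> B'. k y = \<zero>\<^bsub>X\<^esub>} = A'"
  proof -
    have "k y = \<zero>\<^bsub>X\<^esub> \<longleftrightarrow> y \<in> A'" if y: "y \<in> B'" for y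
    proof -
      obtain b where b: "b \<in> B" "\<rho> b y" using cov(1)[OF y] by blast
      then show ?thesis using kb[OF b(1) y b(2)] iff[OF b(1) y b(2)] h(3) by auto
    qed
    then show ?thesis using A' by blast
  qed
  ultimately show ?thesis using X k(1) by (auto simp: fstep_def)
qed

text \<open>\<open>fchain M Q T \<C>\<close>: the members of \<open>\<C>\<close>, ordered by inclusion, form an \<open>\<X>\<close>-filtration
  of \<open>T/Q\<close>. Well-orderedness is automatic, because \<open>\<C>\<close> is closed under unions and each member
  has an immediate successor.\<close>

definition fchain :: "('r, 'b) module \<Rightarrow> 'b set \<Rightarrow> 'b set \<Rightarrow> 'b set set \<Rightarrow> bool" where
  "fchain M Q T \<C> \<longleftrightarrow>
    (\<forall>A\<in>\<C>. submodule A R M \<and> Q \<subseteq> A \<and> A \<subseteq> T) \<and> Q \<in> \<C> \<and> T \<in> \<C> \<and>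
    (\<forall>A\<in>\<C>. \<forall>B\<in>\<C>. A \<subseteq> B \<or> B \<subseteq> A) \<and>
    (\<forall>\<D>. \<D> \<subseteq> \<C> \<longrightarrow> \<D> \<noteq> {} \<longrightarrow> \<Union>\<D> \<in> \<C>) \<and>
    (\<forall>A\<in>\<C>. A \<noteq> T \<longrightarrow> (\<exists>B\<in>\<C>. fstep M A B \<and> (\<forall>C\<in>\<C>. C \<subseteq> A \<or> B \<subseteq> C)))"

lemma fchainD:
  assumes "fchain M Q T \<C>"
  shows "A \<in> \<C> \<Longrightarrow> submodule A R M" "A \<in> \<C> \<Longrightarrow> Q \<subseteq> A" "A \<in> \<C> \<Longrightarrow> A \<subseteq> T" "Q \<in> \<C>" "T \<in> \<C>"
    "A \<in> \<C> \<Longrightarrow> B \<in> \<C> \<Longrightarrow> A \<subseteq> B \<or> B \<subseteq> A"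
    "\<D> \<subseteq> \<C> \<Longrightarrow> \<D> \<noteq> {} \<Longrightarrow> \<Union>\<D> \<in> \<C>"
    "A \<in> \<C> \<Longrightarrow> A \<noteq> T \<Longrightarrow> \<exists>B\<in>\<C>. fstep M A B \<and> (\<forall>C\<in>\<C>. C \<subseteq> A \<or> B \<subseteq> C)"
proof -
  have sub: "\<forall>A\<in>\<C>. submodule A R M \<and> Q \<subseteq> A \<and> A \<subseteq> T" and "Q \<in> \<C>" "T \<in> \<C>"
    and chain: "\<forall>A\<in>\<C>. \<forall>B\<in>\<C>. A \<subseteq> B \<or> B \<subseteq> A"
    and union: "\<forall>\<D>. \<D> \<subseteq> \<C> \<longrightarrow> \<D> \<noteq> {} \<longrightarrow> \<Union>\<D> \<in> \<C>"
    and step: "\<forall>A\<in>\<C>. A \<noteq> T \<longrightarrow> (\<exists>B\<in>\<C>. fstep M A B \<and> (\<forall>C\<in>\<C>. C \<subseteq> A \<or> B \<subseteq> C))"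
    using assms unfolding fchain_def by - (elim conjE, assumption)+
  then show "Q \<in> \<C>" "T \<in> \<C>" by -
  show "A \<in> \<C> \<Longrightarrow> submodule A R M" "A \<in> \<C> \<Longrightarrow> Q \<subseteq> A" "A \<in> \<C> \<Longrightarrow> A \<subseteq> T" using sub by auto
  show "A \<in> \<C> \<Longrightarrow> B \<in> \<C> \<Longrightarrow> A \<subseteq> B \<or> B \<subseteq> A" using chain by blast
  show "\<D> \<subseteq> \<C> \<Longrightarrow> \<D> \<noteq> {} \<Longrightarrow> \<Union>\<D> \<in> \<C>" using union by blast
  show "A \<in> \<C> \<Longrightarrow> A \<noteq> T \<Longrightarrow> \<exists>B\<in>\<C>. fstep M A B \<and> (\<forall>C\<in>\<C>. C \<subseteq> A \<or> B \<subseteq> C)"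
    using step[rule_format] .
qed

lemma fchainI:
  assumes "\<And>A. A \<in> \<C> \<Longrightarrow> submodule A R M \<and> Q \<subseteq> A \<and> A \<subseteq> T" "Q \<in> \<C>" "T \<in> \<C>"
    "\<And>A B. A \<in> \<C> \<Longrightarrow> B \<in> \<C> \<Longrightarrow> A \<subseteq> B \<or> B \<subseteq> A"
    "\<And>\<D>. \<D> \<subseteq> \<C> \<Longrightarrow> \<D> \<noteq> {} \<Longrightarrow> \<Union>\<D> \<in> \<C>"
    "\<And>A. A \<in> \<C> \<Longrightarrow> A \<noteq> T \<Longrightarrow> \<exists>B\<in>\<C>. fstep M A B \<and> (\<forall>C\<in>\<C>. C \<subseteq> A \<or> B \<subseteq> C)"
  shows "fchain M Q T \<C>"
  unfolding fchain_def
  by (intro conjI ballI allI impI)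
    (rule assms(1)[THEN conjunct1] assms(1)[THEN conjunct2, THEN conjunct1]
      assms(1)[THEN conjunct2, THEN conjunct2] assms(2-6) | assumption)+

lemma fchain_restrict:
  assumes M: "left_module R M" and c: "fchain M Q T \<C>"
  shows "fchain (M\<lparr>carrier := T\<rparr>) Q T \<C>"
proof -
  have "submodule A R (M\<lparr>carrier := T\<rparr>)" if "A \<in> \<C>" for A
    using left_module.submodule_restrict_iff[OF M fchainD(1)[OF c fchainD(5)[OF c]]]
      fchainD(1,3)[OF c that] by simp
  then show ?thesis using c by (simp add: fchain_def)
qed

lemma fchain_induct [consumes 2, case_names base step union]:
  assumes c: "fchain M Q T \<C>" and A: "A \<in> \<C>"
    and base: "P Q"
    and step: "\<And>A B. A \<in> \<C> \<Longrightarrow> B \<in> \<C> \<Longrightarrow> fstep M A B \<Longrightarrow> P A \<Longrightarrow> P B"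
    and union: "\<And>\<D>. \<D> \<subseteq> \<C> \<Longrightarrow> \<D> \<noteq> {} \<Longrightarrow> (\<And>D. D \<in> \<D> \<Longrightarrow> P D) \<Longrightarrow> P (\<Union>\<D>)"
  shows "P A"
proof -
  define \<D> where "\<D> = {C \<in> \<C>. \<forall>D\<in>\<C>. D \<subseteq> C \<longrightarrow> P D}"
  have "D = Q" if "D \<in> \<C>" "D \<subseteq> Q" for D using fchainD(2)[OF c that(1)] that(2) by blast
  then have "Q \<in> \<D>" using fchainD(4)[OF c] base by (auto simp: \<D>_def)
  then have ne: "\<D> \<noteq> {}" by blast
  have \<D>: "\<D> \<subseteq> \<C>" "\<And>D. D \<in> \<D> \<Longrightarrow> P D" by (auto simp: \<D>_def)
  have U: "\<Union>\<D> \<in> \<C>" by (rule fchainD(7)[OF c \<D>(1) ne])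
  have PU: "P (\<Union>\<D>)" by (rule union[OF \<D>(1) ne \<D>(2)])
  have below: "P D" if D: "D \<in> \<C>" "D \<subseteq> \<Union>\<D>" for D
  proof (cases "D = \<Union>\<D>")
    case False
    then obtain C where "C \<in> \<D>" "\<not> C \<subseteq> D" using D(2) by blast
    then show ?thesis using fchainD(6)[OF c, of C D] D(1) by (auto simp: \<D>_def)
  qed (use PU in simp)
  have "\<Union>\<D> = T"
  proof (rule ccontr)
    assume "\<Union>\<D> \<noteq> T"
    then obtain B where B: "B \<in> \<C>" "fstep M (\<Union>\<D>) B" "\<forall>C\<in>\<C>. C \<subseteq> \<Union>\<D> \<or> B \<subseteq> C"
      using fchainD(8)[OF c U] by blast
    have "P D" if D: "D \<in> \<C>" "D \<subseteq> B" for D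
    proof (cases "D \<subseteq> \<Union>\<D>")
      case False
      then have "D = B" using B(3) D by blast
      then show ?thesis using step[OF U B(1,2) PU] by simp
    qed (rule below[OF D(1)])
    then have "B \<in> \<D>" using B(1) by (auto simp: \<D>_def)
    then show False using fstep_subset[OF B(2)] by blast
  qed
  then show ?thesis using below[OF A] fchainD(3)[OF c A] by simp
qed

lemma fchain_map:
  assumes c: "fchain M Q T \<C>"
    and sub: "\<And>A. A \<in> \<C> \<Longrightarrow> submodule (\<Phi> A) R N"
    and union: "\<And>\<D>. \<D> \<subseteq> \<C> \<Longrightarrow> \<D> \<noteq> {} \<Longrightarrow> \<Phi> (\<Union>\<D>) = \<Union>(\<Phi> ` \<D>)"
    and step: "\<And>A B. \<lbrakk>A \<in> \<C>; B \<in> \<C>; fstep M A B; \<forall>C\<in>\<C>. C \<subseteq> A \<or> B \<subseteq> C\<rbrakk> \<Longrightarrow>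
      \<Phi> B \<subseteq> \<Phi> A \<or> fstep N (\<Phi> A) (\<Phi> B)"
  shows "fchain N (\<Phi> Q) (\<Phi> T) (\<Phi> ` \<C>)"
proof -
  have mono: "\<Phi> A \<subseteq> \<Phi> B" if "A \<in> \<C>" "B \<in> \<C>" "A \<subseteq> B" for A B
    using union[of "{A, B}"] that by (auto simp: Un_absorb1)
  have st: "\<exists>B\<in>\<Phi> ` \<C>. fstep N A B \<and> (\<forall>C\<in>\<Phi> ` \<C>. C \<subseteq> A \<or> B \<subseteq> C)"
    if A: "A \<in> \<Phi> ` \<C>" "A \<noteq> \<Phi> T" for A
  proof -
    define \<D> where "\<D> = {D \<in> \<C>. \<Phi> D = A}"
    have D: "\<D> \<subseteq> \<C>" "\<D> \<noteq> {}" using A by (auto simp: \<D>_def)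
    have U: "\<Union>\<D> \<in> \<C>" by (rule fchainD(7)[OF c D])
    have \<Phi>U: "\<Phi> (\<Union>\<D>) = A" unfolding union[OF D] using D(2) by (auto simp: \<D>_def)
    then have "\<Union>\<D> \<noteq> T" using A by auto
    then obtain B where B: "B \<in> \<C>" "fstep M (\<Union>\<D>) B" "\<forall>C\<in>\<C>. C \<subseteq> \<Union>\<D> \<or> B \<subseteq> C"
      using fchainD(8)[OF c U] by blast
    have "\<Phi> B \<noteq> A" using B(1) fstep_subset[OF B(2)] by (auto simp: \<D>_def)
    moreover have "A \<subseteq> \<Phi> B" using mono[OF U B(1)] fstep_subset[OF B(2)] \<Phi>U by blast
    ultimately have "fstep N A (\<Phi> B)" using step[OF U B] \<Phi>U by auto
    moreover have "\<Phi> C \<subseteq> A \<or> \<Phi> B \<subseteq> \<Phi> C" if C: "C \<in> \<C>" for C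
      using mono[OF C U] mono[OF B(1) C] B(3) C \<Phi>U by blast
    ultimately show ?thesis using B(1) by (intro bexI[of _ "\<Phi> B"]) auto
  qed
  have un: "\<Union>\<E> \<in> \<Phi> ` \<C>" if \<E>: "\<E> \<subseteq> \<Phi> ` \<C>" "\<E> \<noteq> {}" for \<E>
  proof -
    obtain \<D> where D: "\<D> \<subseteq> \<C>" "\<E> = \<Phi> ` \<D>" using \<E>(1) by (meson subset_imageE)
    then have ne: "\<D> \<noteq> {}" using \<E>(2) by blast
    show ?thesis using union[OF D(1) ne] fchainD(7)[OF c D(1) ne] D(2) by (metis image_eqI)
  qed
  have ch: "A \<subseteq> B \<or> B \<subseteq> A" if "A \<in> \<Phi> ` \<C>" "B \<in> \<Phi> ` \<C>" for A B
  proof -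
    obtain C D where "C \<in> \<C>" "D \<in> \<C>" "A = \<Phi> C" "B = \<Phi> D" using \<open>A \<in> _\<close> \<open>B \<in> _\<close> by blast
    then show ?thesis using mono[of C D] mono[of D C] fchainD(6)[OF c, of C D] by blast
  qed
  have sb: "submodule A R N \<and> \<Phi> Q \<subseteq> A \<and> A \<subseteq> \<Phi> T" if "A \<in> \<Phi> ` \<C>" for A
  proof -
    obtain C where C: "C \<in> \<C>" "A = \<Phi> C" using \<open>A \<in> _\<close> by blast
    show ?thesis
      using mono[OF fchainD(4)[OF c] C(1)] mono[OF C(1) fchainD(5)[OF c]] fchainD(2,3)[OF c C(1)] sub C
      by simp
  qed
  show ?thesis
    by (rule fchainI[OF sb imageI[OF fchainD(4)[OF c]] imageI[OF fchainD(5)[OF c]] ch un st])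
qed

lemma fchain_glue:
  assumes c: "fchain M Q T \<C>" and d: "fchain M T U \<D>"
  shows "fchain M Q U (\<C> \<union> \<D>)"
proof -
  note C = fchainD[OF c] and D = fchainD[OF d]
  have le: "A \<subseteq> B" if "A \<in> \<C>" "B \<in> \<D>" for A B using that C(3) D(2) by blast
  have un: "\<Union>\<E> \<in> \<C> \<union> \<D>" if \<E>: "\<E> \<subseteq> \<C> \<union> \<D>" "\<E> \<noteq> {}" for \<E>
  proof (cases "\<E> \<inter> \<D> = {}")
    case True
    then show ?thesis using \<E> C(7)[of \<E>] by blast
  next
    case False
    then have "\<Union>(\<E> \<inter> \<D>) \<in> \<D>" using D(7)[of "\<E> \<inter> \<D>"] by blast
    moreover have "\<Union>\<E> = \<Union>(\<E> \<inter> \<D>)" using False \<E> le by blast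
    ultimately show ?thesis by simp
  qed
  have st: "\<exists>B\<in>\<C> \<union> \<D>. fstep M A B \<and> (\<forall>C\<in>\<C> \<union> \<D>. C \<subseteq> A \<or> B \<subseteq> C)"
    if A: "A \<in> \<C> \<union> \<D>" "A \<noteq> U" for A
  proof (cases "A \<in> \<D>")
    case True
    obtain B where B: "B \<in> \<D>" "fstep M A B" "\<forall>C\<in>\<D>. C \<subseteq> A \<or> B \<subseteq> C"
      using D(8)[OF True A(2)] by blast
    have "\<forall>C\<in>\<C> \<union> \<D>. C \<subseteq> A \<or> B \<subseteq> C" using B(3) le[OF _ True] by (meson UnE)
    then show ?thesis using B(1,2) by (meson UnI2)
  next
    case False
    then have "A \<in> \<C>" "A \<noteq> T" using A D(4) by auto
    then obtain B where B: "B \<in> \<C>" "fstep M A B" "\<forall>C\<in>\<C>. C \<subseteq> A \<or> B \<subseteq> C"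
      using C(8)[of A] by metis
    have "\<forall>C\<in>\<C> \<union> \<D>. C \<subseteq> A \<or> B \<subseteq> C" using B(3) le[OF B(1)] by (meson UnE)
    then show ?thesis using B(1,2) by (meson UnI1)
  qed
  have sub: "submodule A R M \<and> Q \<subseteq> A \<and> A \<subseteq> U" if "A \<in> \<C> \<union> \<D>" for A
    using that C(1-5) D(1-5) le by blast
  have ch: "A \<subseteq> B \<or> B \<subseteq> A" if "A \<in> \<C> \<union> \<D>" "B \<in> \<C> \<union> \<D>" for A B
    using that C(6) D(6) le by blast
  show ?thesis by (rule fchainI[OF sub UnI1[OF C(4)] UnI2[OF D(5)] ch un st])
qed

lemma X_filtration_imp_fchain:
  fixes r :: "'i rel"
  assumes M: "left_module R M" and filt: "X_filtration R \<X> M r \<mu> F"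
  shows "fchain M {\<zero>\<^bsub>M\<^esub>} (carrier M) (F ` Field r)"
proof -
  interpret M: left_module R M by fact
  have fl: "filtration R M r \<mu> F"
    and fac: "\<And>i. i \<in> Field r \<Longrightarrow> i \<noteq> \<mu> \<Longrightarrow> \<exists>X\<in>\<X>. lmod_isomorphic R
      (quotient_module (M\<lparr>carrier := F (wo_rel.suc r {i})\<rparr>) (F i)) X"
    using filt unfolding X_filtration_def by auto
  have r: "Well_order r" and \<mu>_in: "\<mu> \<in> Field r"
    and \<mu>_all: "\<forall>i\<in>Field r. (i, \<mu>) \<in> r"
    and sub_all: "\<forall>i\<in>Field r. submodule (F i) R M"
    and mono_all: "\<forall>i j. (i, j) \<in> r \<longrightarrow> F i \<subseteq> F j"
    and zero_all: "\<forall>i\<in>Field r. underS r i = {} \<longrightarrow> F i = {\<zero>\<^bsub>M\<^esub>}"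
    and top: "F \<mu> = carrier M"
    and lim_all: "\<forall>i. wo_limit r i \<longrightarrow> F i = (\<Union>j\<in>underS r i. F j)"
    using fl unfolding filtration_def by - (elim conjE, assumption)+
  note \<mu> = \<mu>_in \<mu>_all[rule_format] and sub = sub_all[rule_format] and mono = mono_all[rule_format]
    and zero = zero_all[rule_format] and lim = lim_all[rule_format]
  interpret r: wo_rel r using r by (rule wo_rel.intro)
  have tot: "(i, j) \<in> r \<or> (j, i) \<in> r" if "i \<in> Field r" "j \<in> Field r" for i j
    using r.TOTALS that by blast
  have antisym: "i = j" if "(i, j) \<in> r" "(j, i) \<in> r" for i j
    using r.ANTISYM that by (rule antisymD)
  have least: "\<exists>i\<in>Field r. P i \<and> (\<forall>j\<in>underS r i. \<not> P j)" if "\<exists>i\<in>Field r. P i" for P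
  proof -
    let ?S = "{i \<in> Field r. P i}"
    have "r.minim ?S \<in> ?S" "\<And>j. j \<in> ?S \<Longrightarrow> (r.minim ?S, j) \<in> r"
      using that r.minim_in[of ?S] r.minim_least[of ?S] by auto
    then show ?thesis
      using antisym by (intro bexI[of _ "r.minim ?S"]) (auto simp: underS_def Field_def)
  qed
  have cases: "underS r k = {} \<or> wo_limit r k \<or> (\<exists>i\<in>underS r k. wo_rel.suc r {i} = k)"
    if "k \<in> Field r" for k
    using that unfolding wo_limit_def by blast
  have underS: "j \<in> underS r i \<longleftrightarrow> j \<in> Field r \<and> (i, j) \<notin> r" if "i \<in> Field r" for i j
    using that tot antisym by (auto simp: underS_def Field_def)
  have suc: "(k, j) \<in> r" if "i \<in> underS r k" "wo_rel.suc r {i} = k" "(j, i) \<notin> r" "j \<in> Field r"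
    for i j k
  proof -
    have "(i, j) \<in> r" "i \<noteq> j"
      using that tot[of i j] tot[of i i] by (auto simp: underS_def Field_def)
    then show ?thesis using wo_suc_least(3)[OF r] that(2) by metis
  qed
  have zero_in: "{\<zero>\<^bsub>M\<^esub>} \<subseteq> F i" if "i \<in> Field r" for i
    using M.submoduleD(2)[OF sub[OF that]] by simp
  have chain: "A \<subseteq> B \<or> B \<subseteq> A" if "A \<in> F ` Field r" "B \<in> F ` Field r" for A B
    using that tot mono by blast
  have union: "\<Union>\<D> \<in> F ` Field r" if \<D>: "\<D> \<subseteq> F ` Field r" "\<D> \<noteq> {}" for \<D>
  proof -
    have "\<exists>k\<in>Field r. \<Union>\<D> \<subseteq> F k"
      using \<mu> \<D>(1) mono top by (intro bexI[of _ \<mu>]) blast+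
    then obtain k where k: "k \<in> Field r" "\<Union>\<D> \<subseteq> F k" "\<And>j. j \<in> underS r k \<Longrightarrow> \<not> \<Union>\<D> \<subseteq> F j"
      using least[of "\<lambda>k. \<Union>\<D> \<subseteq> F k"] by blast
    have small: "F j \<subseteq> \<Union>\<D>" if j: "j \<in> underS r k" for j
    proof -
      obtain D where "D \<in> \<D>" "\<not> D \<subseteq> F j" using k(3)[OF j] by blast
      then show ?thesis using chain[of D "F j"] \<D>(1) underS[OF k(1)] j by blast
    qed
    consider "underS r k = {}" | "wo_limit r k"
      | i where "i \<in> underS r k" "wo_rel.suc r {i} = k" using cases[OF k(1)] by blast
    then have "F k \<subseteq> \<Union>\<D>"
    proof cases
      case 1
      obtain D where D: "D \<in> \<D>" using \<D>(2) by blast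
      then obtain j where "j \<in> Field r" "D = F j" using \<D>(1) by blast
      then show ?thesis using zero[OF k(1) 1] zero_in[of j] D by blast
    next
      case 2
      then show ?thesis using lim small by blast
    next
      case (3 i)
      obtain D where D: "D \<in> \<D>" "\<not> D \<subseteq> F i" using k(3)[OF 3(1)] by blast
      then obtain j where j: "j \<in> Field r" "D = F j" using \<D>(1) by blast
      then have "(k, j) \<in> r" using suc[OF 3] D mono by blast
      then show ?thesis using mono D(1) j by blast
    qed
    then show ?thesis using k(1,2) by blast
  qed
  have step: "\<exists>B\<in>F ` Field r. fstep M A B \<and> (\<forall>C\<in>F ` Field r. C \<subseteq> A \<or> B \<subseteq> C)"
    if A: "A \<in> F ` Field r" "A \<noteq> carrier M" for A
  proof -
    obtain l where l: "l \<in> Field r" "A = F l" using A(1) by blast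
    have "\<not> F \<mu> \<subseteq> A" using A(2) top M.submoduleD(1)[OF sub[OF l(1)]] l by blast
    then obtain k where k: "k \<in> Field r" "\<not> F k \<subseteq> A" "\<And>j. j \<in> underS r k \<Longrightarrow> F j \<subseteq> A"
      using least[of "\<lambda>k. \<not> F k \<subseteq> A"] \<mu> by blast
    have "(k, l) \<notin> r" using k(2) l mono by blast
    then have lk: "l \<in> underS r k" using l underS[OF k(1)] by simp
    have "\<not> wo_limit r k" using lim[of k] k by blast
    then obtain i where i: "i \<in> underS r k" "wo_rel.suc r {i} = k" using cases[OF k(1)] lk by blast
    have iF: "i \<in> Field r" using i underS[OF k(1)] by blast
    have "(l, i) \<in> r" using suc[OF i _ l(1)] \<open>(k, l) \<notin> r\<close> by blast
    then have Ai: "F i = A" using mono l k(3)[OF i(1)] by blast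
    have ik: "F i \<subseteq> F k" using i mono by (auto simp: underS_def)
    have "i \<noteq> \<mu>" using Ai A(2) top by auto
    then have "fstep M A (F k)"
      using fac[OF iF] i Ai ik fstep_iff_quotient[OF M sub[OF k(1)] sub[OF iF]] by simp
    moreover have "F c \<subseteq> A \<or> F k \<subseteq> F c" if "c \<in> Field r" for c
      using k(3)[of c] underS[OF k(1)] that mono by blast
    ultimately show ?thesis using k(1) by blast
  qed
  obtain z where z: "z \<in> Field r" "underS r z = {}" using least[of "\<lambda>_. True"] \<mu>(1) by blast
  have bot: "{\<zero>\<^bsub>M\<^esub>} \<in> F ` Field r" using imageI[OF z(1), of F] zero[OF z] by simp
  have tp: "carrier M \<in> F ` Field r" using imageI[OF \<mu>(1), of F] top by simp
  have sb: "submodule A R M \<and> {\<zero>\<^bsub>M\<^esub>} \<subseteq> A \<and> A \<subseteq> carrier M" if "A \<in> F ` Field r" for A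
    using that sub zero_in M.submoduleD(1) by blast
  show ?thesis by (rule fchainI[OF sb bot tp chain union step])
qed

lemma fchain_imp_Filt:
  assumes M: "left_module R M" and c: "fchain M {\<zero>\<^bsub>M\<^esub>} (carrier M) \<C>"
  shows "Filt R \<X> M"
proof -
  interpret M: left_module R M by fact
  note C = fchainD[OF c]
  define s where "s = {(A, B). A \<in> \<C> \<and> B \<in> \<C> \<and> A \<subseteq> B}"
  have Fs: "Field s = \<C>" by (auto simp: s_def Field_def)
  have s: "Well_order s"
    unfolding Fs order_on_defs
  proof (intro conjI)
    show "s \<subseteq> \<C> \<times> \<C>" "refl_on \<C> s" by (auto simp: s_def refl_on_def)
    show "trans s" by (auto simp: s_def trans_def)
    show "antisym s" by (auto simp: s_def antisym_def)
    show "total_on \<C> s" using C(6) by (auto simp: s_def total_on_def)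
    show "wf (s - Id)"
    proof (rule wfI_min)
      fix x and E :: "'a set set" assume x: "x \<in> E"
      show "\<exists>z\<in>E. \<forall>y. (y, z) \<in> s - Id \<longrightarrow> y \<notin> E"
      proof (cases "E \<inter> \<C> = {}")
        case True
        then show ?thesis using x by (auto simp: s_def)
      next
        case False
        define \<D> where "\<D> = {D \<in> \<C>. \<forall>B\<in>E \<inter> \<C>. D \<subseteq> B}"
        have "{\<zero>\<^bsub>M\<^esub>} \<in> \<D>" using C(2,4) by (auto simp: \<D>_def)
        then have L: "\<Union>\<D> \<in> \<C>" using C(7)[of \<D>] by (auto simp: \<D>_def)
        have le: "\<Union>\<D> \<subseteq> B" if "B \<in> E \<inter> \<C>" for B using that by (auto simp: \<D>_def)
        have "\<Union>\<D> \<in> E"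
        proof (rule ccontr)
          assume nE: "\<Union>\<D> \<notin> E"
          obtain B where B: "B \<in> E \<inter> \<C>" using False by blast
          then have "\<Union>\<D> \<noteq> carrier M" using le[OF B] C(3)[of B] nE by (metis IntD1 IntD2 subset_antisym)
          then obtain B where B: "B \<in> \<C>" "fstep M (\<Union>\<D>) B" "\<forall>C\<in>\<C>. C \<subseteq> \<Union>\<D> \<or> B \<subseteq> C"
            using C(8)[OF L] by blast
          have "B \<subseteq> B'" if B': "B' \<in> E \<inter> \<C>" for B'
          proof -
            have "B' \<noteq> \<Union>\<D>" using B' nE by blast
            then show ?thesis using B(3) le[OF B'] B' by blast
          qed
          then have "B \<in> \<D>" using B(1) by (simp add: \<D>_def)
          then show False using fstep_subset[OF B(2)] by blast
        qed
        then show ?thesis using le L by (intro bexI[of _ "\<Union>\<D>"]) (auto simp: s_def)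
      qed
    qed
  qed
  have underS: "underS s A = {B \<in> \<C>. B \<subset> A}" if "A \<in> \<C>" for A
    using that by (auto simp: underS_def s_def)
  have suc: "wo_rel.suc s {A} = B"
    if "A \<in> \<C>" "B \<in> \<C>" "A \<subset> B" "\<forall>C\<in>\<C>. C \<subseteq> A \<or> B \<subseteq> C" for A B
    by (rule wo_suc_eqI[OF s]) (use that in \<open>auto simp: s_def\<close>)
  have "X_filtration R \<X> M s (carrier M) (\<lambda>A. A)"
    unfolding X_filtration_def filtration_def Fs
  proof (intro conjI ballI allI impI)
    show "well_order_on \<C> s" using s Fs by simp
    show "carrier M \<in> \<C>" by (rule C(5))
    show "carrier M = carrier M" ..
    show "(A, carrier M) \<in> s" if "A \<in> \<C>" for A using that C(3,5) by (auto simp: s_def)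
    show "submodule A R M" if "A \<in> \<C>" for A using C(1) that .
    show "A \<subseteq> B" if "(A, B) \<in> s" for A B using that by (auto simp: s_def)
    show "A = {\<zero>\<^bsub>M\<^esub>}" if "A \<in> \<C>" "underS s A = {}" for A
      using that underS[OF that(1)] C(2,4) by blast
  next
    fix A assume lA: "wo_limit s A"
    then have A: "A \<in> \<C>" and ne: "underS s A \<noteq> {}" by (auto simp: wo_limit_def Fs)
    define U where "U = \<Union>(underS s A)"
    have U: "U \<in> \<C>" using C(7)[OF _ ne] underS[OF A] unfolding U_def by blast
    have "U \<subseteq> A" using underS[OF A] by (auto simp: U_def)
    have "U = A"
    proof (rule ccontr)
      assume UA: "U \<noteq> A"
      then have "U \<noteq> carrier M" using \<open>U \<subseteq> A\<close> C(3)[OF A] by blast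
      then obtain B where B: "B \<in> \<C>" "fstep M U B" "\<forall>C\<in>\<C>. C \<subseteq> U \<or> B \<subseteq> C"
        using C(8)[OF U] by blast
      have "B \<subseteq> A" using B(3) A UA \<open>U \<subseteq> A\<close> by blast
      moreover have "\<not> B \<subset> A" using fstep_subset[OF B(2)] B(1) underS[OF A] by (auto simp: U_def)
      ultimately have "B = A" by blast
      then have "wo_rel.suc s {U} = A" using suc[OF U B(1)] fstep_subset[OF B(2)] B(3) by simp
      moreover have "U \<in> underS s A" using U UA \<open>U \<subseteq> A\<close> underS[OF A] by blast
      ultimately show False using lA by (auto simp: wo_limit_def)
    qed
    then show "A = (\<Union>B\<in>underS s A. B)" by (simp add: U_def)
  next
    fix A assume A: "A \<in> \<C> - {carrier M}"
    then obtain B where B: "B \<in> \<C>" "fstep M A B" "\<forall>C\<in>\<C>. C \<subseteq> A \<or> B \<subseteq> C" using C(8) by blast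
    have "wo_rel.suc s {A} = B" using suc[of A B] A B fstep_subset[OF B(2)] by blast
    then show "\<exists>X\<in>\<X>. lmod_isomorphic R (quotient_module (M\<lparr>carrier := wo_rel.suc s {A}\<rparr>) A) X"
      using fstep_iff_quotient[OF M C(1)[OF B(1)], of A] B(2) A C(1) fstep_subset[OF B(2)] by auto
  qed
  then show ?thesis by (rule X_filtration_imp_Filt[OF M])
qed

lemma Filt_iff_fchain:
  "Filt R \<X> M \<longleftrightarrow> left_module R M \<and> (\<exists>\<C>. fchain M {\<zero>\<^bsub>M\<^esub>} (carrier M) \<C>)"
  using X_filtration_imp_fchain fchain_imp_Filt unfolding Filt_def by metis

end

section \<open>Maps from bricks into filtered modules\<close>

context semibrick_context
begin

lemma semibrick_hom:
  assumes X: "X \<in> \<X>" "X' \<in> \<X>" and g: "g \<in> lmod_hom R X X'"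
    and nz: "x \<in> carrier X" "g x \<noteq> \<zero>\<^bsub>X'\<^esub>"
  shows "bij_betw g (carrier X) (carrier X')"
proof -
  have eq: "X' = X" using semibrick X g nz unfolding semibrick_def by metis
  define k where "k = restrict g (carrier X)"
  have "division_ring (endo_ring R X)"
    using semibrick X by (auto simp: semibrick_def brick_def)
  then interpret E: division_ring "endo_ring R X" .
  have gD: "g y \<in> carrier X" if "y \<in> carrier X" for y using lmod_homD(1)[OF g that] eq by simp
  interpret X: left_module R X by (rule brick_left_module[OF X(1)])
  have "k \<in> lmod_hom R X X"
    using lmod_homD[OF g] X.smult_closed unfolding eq lmod_hom_def k_def by auto
  then have kE: "k \<in> carrier (endo_ring R X)" by (simp add: endo_ring_def k_def)
  have "k x \<noteq> \<zero>\<^bsub>endo_ring R X\<^esub> x" using nz eq by (simp add: k_def endo_ring_def)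
  then have "k \<in> Units (endo_ring R X)" using kE E.division_ring_Units by auto
  then obtain j where j: "j \<in> carrier (endo_ring R X)"
    "j \<otimes>\<^bsub>endo_ring R X\<^esub> k = \<one>\<^bsub>endo_ring R X\<^esub>" "k \<otimes>\<^bsub>endo_ring R X\<^esub> j = \<one>\<^bsub>endo_ring R X\<^esub>"
    unfolding Units_def by auto
  have jX: "j y \<in> carrier X" if "y \<in> carrier X" for y
    using j(1) that by (auto simp: endo_ring_def lmod_hom_def)
  have "j (g y) = y \<and> g (j y) = y" if y: "y \<in> carrier X" for y
    using fun_cong[OF j(2), of y] fun_cong[OF j(3), of y] y jX[OF y] gD[OF y]
    by (simp add: endo_ring_def k_def compose_def)
  then show ?thesis unfolding eq using gD jX by (intro bij_betw_byWitness[of _ j]) auto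
qed

text \<open>A map \<open>X \<rightarrow> N/Q\<close> out of a brick is given by a presentation \<open>p\<close> of \<open>X\<close> and a map \<open>\<phi>\<close> of
  the free module into \<open>N\<close> that sends the relations into \<open>Q\<close>. If it is nonzero, it splits the first
  step of the chain whose upper end contains its image, so it can be divided out of the chain.\<close>

lemma brick_map_dichotomy:
  assumes N: "left_module R N" and c: "fchain N Q (carrier N) \<C>" and X: "X \<in> \<X>"
    and p: "p \<in> lmod_hom R (free_module R n) X" "p ` carrier (free_module R n) = carrier X"
    and \<phi>: "\<phi> \<in> lmod_hom R (free_module R n) N"
    and ker: "\<And>v. v \<in> carrier (free_module R n) \<Longrightarrow> p v = \<zero>\<^bsub>X\<^esub> \<Longrightarrow> \<phi> v \<in> Q"
  shows "\<phi> ` carrier (free_module R n) \<subseteq> Q \<or>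
    (\<forall>v\<in>carrier (free_module R n). \<phi> v \<in> Q \<longrightarrow> p v = \<zero>\<^bsub>X\<^esub>) \<and>
    (\<exists>\<C>'. fchain N (Q <+>\<^bsub>N\<^esub> \<phi> ` carrier (free_module R n)) (carrier N) \<C>')"
proof -
  let ?F = "free_module R n"
  define Y where "Y = \<phi> ` carrier ?F"
  note C = fchainD[OF c]
  interpret F: left_module R ?F by (rule free_module_left_module[OF ring])
  interpret N: left_module R N by fact
  interpret \<phi>: lmod_hom_pair R ?F N \<phi> by (rule lmod_hom_pairI[OF F.left_module_axioms N \<phi>])
  interpret p: lmod_hom_pair R ?F X p
    by (rule lmod_hom_pairI[OF F.left_module_axioms brick_left_module[OF X] p(1)])
  have Y: "submodule Y R N" unfolding Y_def by (rule \<phi>.submodule_image[OF F.submodule_carrier])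
  note YD = N.submoduleD[OF Y]
  define \<D> where "\<D> = {A \<in> \<C>. \<not> Y \<subseteq> A}"
  show ?thesis
  proof (cases "\<D> = {}")
    case True
    then show ?thesis using C(4) by (auto simp: \<D>_def Y_def)
  next
    case ne: False
    have \<D>: "\<D> \<subseteq> \<C>" by (auto simp: \<D>_def)
    define A where "A = \<Union>\<D>"
    have A: "A \<in> \<C>" unfolding A_def by (rule C(7)[OF \<D> ne])
    have nYA: "\<not> Y \<subseteq> A"
    proof
      assume YA: "Y \<subseteq> A"
      have "(\<lambda>i. \<phi> (unit_vec R n i)) ` {..<n} \<subseteq> \<Union>\<D>"
        using YA F.unit_vec_closed unfolding Y_def A_def by blast
      moreover have "subset.chain UNIV \<D>"
        using C(6) \<D> by (auto simp: subset_chain_def)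
      ultimately obtain D where D: "D \<in> \<D>" "(\<lambda>i. \<phi> (unit_vec R n i)) ` {..<n} \<subseteq> D"
        using finite_subset_Union_chain[of "(\<lambda>i. \<phi> (unit_vec R n i)) ` {..<n}" \<D> UNIV] ne by auto
      then have "submodule D R N" using C(1) \<D> by blast
      then have "Y \<subseteq> D" using N.hom_free_range[OF \<phi>] D(2) unfolding Y_def by blast
      then show False using D(1) by (simp add: \<D>_def)
    qed
    then have "A \<noteq> carrier N" using YD(1) by blast
    then obtain B where B: "B \<in> \<C>" "fstep N A B" and gap: "\<And>C. C \<in> \<C> \<Longrightarrow> C \<subseteq> A \<or> B \<subseteq> C"
      using C(8)[OF A] by metis
    have AB: "A \<subset> B" by (rule fstep_subset[OF B(2)])
    then have YB: "Y \<subseteq> B" using B(1) unfolding A_def \<D>_def by blast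
    obtain X' h where X': "X' \<in> \<X>" and h: "h \<in> lmod_hom R (N\<lparr>carrier := B\<rparr>) X'"
      "h ` B = carrier X'" "{b \<in> B. h b = \<zero>\<^bsub>X'\<^esub>} = A" using B(2) by (rule fstepE)
    interpret X': left_module R X' by (rule brick_left_module[OF X'])
    interpret h: lmod_hom_pair R "N\<lparr>carrier := B\<rparr>" X' h
      by (rule lmod_hom_pairI[OF N.left_module_submodule[OF C(1)[OF B(1)]] brick_left_module[OF X'] h(1)])
    note hD = h.homD[simplified]
    have \<phi>B: "\<phi> v \<in> B" if "v \<in> carrier ?F" for v using YB that by (auto simp: Y_def)
    have hker: "h b = \<zero>\<^bsub>X'\<^esub> \<longleftrightarrow> b \<in> A" if "b \<in> B" for b using h(3) that by blast
    define \<sigma> where "\<sigma> x x' \<longleftrightarrow> (\<exists>v\<in>carrier ?F. p v = x \<and> h (\<phi> v) = x')" for x x'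
    obtain g where g: "g \<in> lmod_hom R X X'" and g_iff: "\<And>x x'. x \<in> carrier X \<Longrightarrow> x' \<in> carrier X' \<Longrightarrow>
      \<sigma> x x' \<longleftrightarrow> g x = x'"
    proof (rule linear_relation_hom[OF brick_left_module[OF X] brick_left_module[OF X'], of \<sigma>])
      fix x assume "x \<in> carrier X"
      then obtain v where v: "v \<in> carrier ?F" "x = p v" using p(2) by blast
      then have "\<sigma> x (h (\<phi> v))" by (auto simp: \<sigma>_def)
      then show "\<exists>x'\<in>carrier X'. \<sigma> x x'" using hD(1)[OF \<phi>B[OF v(1)]] by blast
    next
      fix x x' y y' assume "\<sigma> x x'" "\<sigma> y y'"
      then obtain v w where vw: "v \<in> carrier ?F" "w \<in> carrier ?F"
        and e: "p v = x" "h (\<phi> v) = x'" "p w = y" "h (\<phi> w) = y'" by (auto simp: \<sigma>_def)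
      show "\<sigma> (x \<oplus>\<^bsub>X\<^esub> y) (x' \<oplus>\<^bsub>X'\<^esub> y')"
        unfolding \<sigma>_def
        using e p.homD(2)[OF vw] \<phi>.homD(2)[OF vw] hD(2)[OF \<phi>B[OF vw(1)] \<phi>B[OF vw(2)]]
        by (intro bexI[of _ "v \<oplus>\<^bsub>?F\<^esub> w"]) (simp_all add: vw)
    next
      fix a x x' assume a: "a \<in> carrier R" and "\<sigma> x x'"
      then obtain v where v: "v \<in> carrier ?F" and e: "p v = x" "h (\<phi> v) = x'"
        by (auto simp: \<sigma>_def)
      show "\<sigma> (a \<odot>\<^bsub>X\<^esub> x) (a \<odot>\<^bsub>X'\<^esub> x')"
        unfolding \<sigma>_def
        using e p.homD(3)[OF a v] \<phi>.homD(3)[OF a v] hD(3)[OF a \<phi>B[OF v]]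
        by (intro bexI[of _ "a \<odot>\<^bsub>?F\<^esub> v"]) (simp_all add: F.smult_closed a v)
    next
      fix x' assume "\<sigma> \<zero>\<^bsub>X\<^esub> x'"
      then obtain v where v: "v \<in> carrier ?F" "p v = \<zero>\<^bsub>X\<^esub>" "h (\<phi> v) = x'" by (auto simp: \<sigma>_def)
      then have "\<phi> v \<in> A" using ker[OF v(1,2)] C(2)[OF A] by blast
      then show "x' = \<zero>\<^bsub>X'\<^esub>" using hker[OF \<phi>B[OF v(1)]] v(3) by simp
    qed simp
    have gp: "g (p v) = h (\<phi> v)" if v: "v \<in> carrier ?F" for v
      using g_iff[OF p.homD(1)[OF v] hD(1)[OF \<phi>B[OF v]]] v unfolding \<sigma>_def by blast
    obtain v0 where v0: "v0 \<in> carrier ?F" "\<phi> v0 \<notin> A" using nYA by (auto simp: Y_def)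
    have bij: "bij_betw g (carrier X) (carrier X')"
      using semibrick_hom[OF X X' g p.homD(1)[OF v0(1)]] gp[OF v0(1)] hker[OF \<phi>B[OF v0(1)]] v0(2)
      by simp
    interpret g: lmod_hom_pair R X X' g
      by (rule lmod_hom_pairI[OF brick_left_module[OF X] brick_left_module[OF X'] g])
    have inj: "p v = \<zero>\<^bsub>X\<^esub>" if v: "v \<in> carrier ?F" "\<phi> v \<in> A" for v
    proof -
      have "g (p v) = g \<zero>\<^bsub>X\<^esub>" using gp[OF v(1)] hker[OF \<phi>B[OF v(1)]] v(2) g.hom_zero by simp
      then show ?thesis
        using inj_onD[OF bij_betw_imp_inj_on[OF bij]] p.homD(1)[OF v(1)] by simp
    qed
    have YA: "Y \<inter> A \<subseteq> Q" using inj ker by (auto simp: Y_def)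
    have BAY: "b \<in> A <+>\<^bsub>N\<^esub> Y" if b: "b \<in> B" for b
    proof -
      obtain x where x: "x \<in> carrier X" "h b = g x"
        using hD(1)[OF b] bij_betw_imp_surj_on[OF bij] by (metis imageE)
      obtain v where v: "v \<in> carrier ?F" "x = p v" using p(2) x(1) by (metis imageE)
      have bN: "b \<in> carrier N" "\<phi> v \<in> carrier N"
        using N.submoduleD(1)[OF C(1)[OF B(1)]] b \<phi>B[OF v(1)] by auto
      have "b \<ominus>\<^bsub>N\<^esub> \<phi> v \<in> B" by (rule N.submoduleD(6)[OF C(1)[OF B(1)] b \<phi>B[OF v(1)]])
      moreover have "h (b \<ominus>\<^bsub>N\<^esub> \<phi> v) = \<zero>\<^bsub>X'\<^esub>"
      proof -
        have "b \<ominus>\<^bsub>N\<^esub> \<phi> v = b \<oplus>\<^bsub>N\<^esub> (\<ominus>\<^bsub>R\<^esub> \<one>\<^bsub>R\<^esub>) \<odot>\<^bsub>N\<^esub> \<phi> v"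
          using N.smult_minus_one[OF bN(2)] by (simp add: a_minus_def)
        then have "h (b \<ominus>\<^bsub>N\<^esub> \<phi> v) = h b \<oplus>\<^bsub>X'\<^esub> (\<ominus>\<^bsub>R\<^esub> \<one>\<^bsub>R\<^esub>) \<odot>\<^bsub>X'\<^esub> h (\<phi> v)"
          using hD(2)[OF b, of "(\<ominus>\<^bsub>R\<^esub> \<one>\<^bsub>R\<^esub>) \<odot>\<^bsub>N\<^esub> \<phi> v"] hD(3)[of "\<ominus>\<^bsub>R\<^esub> \<one>\<^bsub>R\<^esub>" "\<phi> v"] \<phi>B[OF v(1)]
            N.submoduleD(4)[OF C(1)[OF B(1)], of "\<ominus>\<^bsub>R\<^esub> \<one>\<^bsub>R\<^esub>" "\<phi> v"] by simp
        also have "\<dots> = h b \<ominus>\<^bsub>X'\<^esub> h (\<phi> v)"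
          using X'.smult_minus_one[OF hD(1)[OF \<phi>B[OF v(1)]]] by (simp add: a_minus_def)
        also have "\<dots> = \<zero>\<^bsub>X'\<^esub>"
          using X'.diff_eq_zero_iff hD(1) b \<phi>B[OF v(1)] x(2) gp[OF v(1)] v(2) by simp
        finally show ?thesis .
      qed
      ultimately have "b \<ominus>\<^bsub>N\<^esub> \<phi> v \<in> A" using hker by simp
      moreover have "b = (b \<ominus>\<^bsub>N\<^esub> \<phi> v) \<oplus>\<^bsub>N\<^esub> \<phi> v"
        using N.add_diff_cancel[OF bN] bN by (simp add: N.M.a_comm)
      moreover have "\<phi> v \<in> Y" using v(1) by (simp add: Y_def)
      ultimately show ?thesis unfolding N.set_add_iff by blast
    qed
    have absorb: "D <+>\<^bsub>N\<^esub> Y = D" if D: "D \<in> \<C>" "Y \<subseteq> D" for D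
    proof
      note DD = N.submoduleD[OF C(1)[OF D(1)]]
      show "D <+>\<^bsub>N\<^esub> Y \<subseteq> D" using DD(3) D(2) unfolding subset_iff N.set_add_iff by blast
      show "D \<subseteq> D <+>\<^bsub>N\<^esub> Y"
        using DD(1) YD(2) N.M.r_zero unfolding subset_iff N.set_add_iff by metis
    qed
    have "fchain N (Q <+>\<^bsub>N\<^esub> Y) (carrier N <+>\<^bsub>N\<^esub> Y) ((\<lambda>D. D <+>\<^bsub>N\<^esub> Y) ` \<C>)"
    proof (rule fchain_map[OF c])
      show "submodule (D <+>\<^bsub>N\<^esub> Y) R N" if "D \<in> \<C>" for D
        by (rule N.submodule_set_add[OF C(1)[OF that] Y])
      show "\<Union>\<E> <+>\<^bsub>N\<^esub> Y = (\<Union>D\<in>\<E>. D <+>\<^bsub>N\<^esub> Y)" for \<E> by (auto simp: set_add_def')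
      fix D E assume D: "D \<in> \<C>" and E: "E \<in> \<C>" and st: "fstep N D E"
        and gapD: "\<forall>G\<in>\<C>. G \<subseteq> D \<or> E \<subseteq> G"
      have DE: "D \<subset> E" by (rule fstep_subset[OF st])
      note DD = N.submoduleD[OF C(1)[OF D]] and ED = N.submoduleD[OF C(1)[OF E]]
      consider "B \<subseteq> D" | "D = A" | "E \<subseteq> A" using gap[OF D] gapD A by blast
      then show "E <+>\<^bsub>N\<^esub> Y \<subseteq> D <+>\<^bsub>N\<^esub> Y \<or> fstep N (D <+>\<^bsub>N\<^esub> Y) (E <+>\<^bsub>N\<^esub> Y)"
      proof cases
        case 1
        then show ?thesis using absorb[OF D] absorb[OF E] YB DE st by auto
      next
        case 2
        then have "E \<subseteq> B" using gapD B(1) AB by blast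
        then have "E <+>\<^bsub>N\<^esub> Y \<subseteq> B <+>\<^bsub>N\<^esub> Y" unfolding subset_iff N.set_add_iff by blast
        also have "\<dots> = B" by (rule absorb[OF B(1) YB])
        also have "\<dots> \<subseteq> D <+>\<^bsub>N\<^esub> Y" using BAY 2 by blast
        finally show ?thesis ..
      next
        case 3
        have "fstep N (D <+>\<^bsub>N\<^esub> Y) (E <+>\<^bsub>N\<^esub> Y)"
        proof (rule fstep_transfer[OF N N C(1)[OF E] N.submodule_set_add[OF C(1)[OF E] Y] _ st,
              of _ "\<lambda>b y. \<exists>z\<in>Y. y = b \<oplus>\<^bsub>N\<^esub> z"])
          show "D <+>\<^bsub>N\<^esub> Y \<subseteq> E <+>\<^bsub>N\<^esub> Y" using DE unfolding subset_iff N.set_add_iff by blast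
          show "\<zero>\<^bsub>N\<^esub> \<in> D <+>\<^bsub>N\<^esub> Y" by (rule N.submoduleD(2)[OF N.submodule_set_add[OF C(1)[OF D] Y]])
          show "\<exists>b\<in>E. \<exists>z\<in>Y. y = b \<oplus>\<^bsub>N\<^esub> z" if "y \<in> E <+>\<^bsub>N\<^esub> Y" for y
            using that unfolding N.set_add_iff .
          show "\<exists>y\<in>E <+>\<^bsub>N\<^esub> Y. \<exists>z\<in>Y. y = b \<oplus>\<^bsub>N\<^esub> z" if "b \<in> E" for b
            using that YD(2) unfolding Bex_def N.set_add_iff by blast
        next
          fix b c y z assume bc: "b \<in> E" "c \<in> E" and "\<exists>u\<in>Y. y = b \<oplus>\<^bsub>N\<^esub> u" "\<exists>u\<in>Y. z = c \<oplus>\<^bsub>N\<^esub> u"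
          then obtain u w where uw: "u \<in> Y" "w \<in> Y" "y = b \<oplus>\<^bsub>N\<^esub> u" "z = c \<oplus>\<^bsub>N\<^esub> w" by blast
          have "y \<oplus>\<^bsub>N\<^esub> z = (b \<oplus>\<^bsub>N\<^esub> c) \<oplus>\<^bsub>N\<^esub> (u \<oplus>\<^bsub>N\<^esub> w)"
            using ED(1)[OF bc(1)] ED(1)[OF bc(2)] YD(1)[OF uw(1)] YD(1)[OF uw(2)] uw(3,4)
            by (simp add: N.M.a_ac)
          then show "\<exists>v\<in>Y. y \<oplus>\<^bsub>N\<^esub> z = (b \<oplus>\<^bsub>N\<^esub> c) \<oplus>\<^bsub>N\<^esub> v" using YD(3)[OF uw(1,2)] by blast
        next
          fix a b y assume ab: "a \<in> carrier R" "b \<in> E" and "\<exists>z\<in>Y. y = b \<oplus>\<^bsub>N\<^esub> z"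
          then obtain z where z: "z \<in> Y" "y = b \<oplus>\<^bsub>N\<^esub> z" by blast
          then show "\<exists>z\<in>Y. a \<odot>\<^bsub>N\<^esub> y = (a \<odot>\<^bsub>N\<^esub> b) \<oplus>\<^bsub>N\<^esub> z"
            using N.smult_r_distr[OF ab(1) ED(1)[OF ab(2)] YD(1)[OF z(1)]] YD(4)[OF ab(1) z(1)] by blast
        next
          fix b y assume b: "b \<in> E" and "\<exists>z\<in>Y. y = b \<oplus>\<^bsub>N\<^esub> z"
          then obtain z where z: "z \<in> Y" "y = b \<oplus>\<^bsub>N\<^esub> z" by blast
          show "b \<in> D \<longleftrightarrow> y \<in> D <+>\<^bsub>N\<^esub> Y"
          proof
            show "b \<in> D \<Longrightarrow> y \<in> D <+>\<^bsub>N\<^esub> Y" using z unfolding N.set_add_iff by blast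
            assume "y \<in> D <+>\<^bsub>N\<^esub> Y"
            then obtain d w where dw: "d \<in> D" "w \<in> Y" "b \<oplus>\<^bsub>N\<^esub> z = d \<oplus>\<^bsub>N\<^esub> w"
              using z(2) unfolding N.set_add_iff by metis
            have cr: "b \<in> carrier N" "z \<in> carrier N" "d \<in> carrier N" "w \<in> carrier N"
              using ED(1)[OF b] YD(1)[OF z(1)] DD(1)[OF dw(1)] YD(1)[OF dw(2)] by auto
            have "b \<ominus>\<^bsub>N\<^esub> d = w \<ominus>\<^bsub>N\<^esub> z"
            proof -
              have "b = (d \<oplus>\<^bsub>N\<^esub> w) \<ominus>\<^bsub>N\<^esub> z"
                using N.add_eq_diff[OF cr(1,2)] cr dw(3) by (simp add: N.M.a_comm)
              then have "b = d \<oplus>\<^bsub>N\<^esub> (w \<ominus>\<^bsub>N\<^esub> z)"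
                using cr by (simp add: a_minus_def N.M.a_assoc)
              then show ?thesis using N.add_eq_diff[of "w \<ominus>\<^bsub>N\<^esub> z" d] cr by simp
            qed
            moreover have "b \<ominus>\<^bsub>N\<^esub> d \<in> A" using ED(6)[OF b] dw(1) DE 3 by blast
            moreover have "w \<ominus>\<^bsub>N\<^esub> z \<in> Y" by (rule YD(6)[OF dw(2) z(1)])
            ultimately have "b \<ominus>\<^bsub>N\<^esub> d \<in> D" using YA C(2)[OF D] by auto
            then show "b \<in> D" using N.submodule_diff_iff[OF C(1)[OF D] cr(1,3)] dw(1) by simp
          qed
        qed
        then show ?thesis ..
      qed
    qed
    then have "fchain N (Q <+>\<^bsub>N\<^esub> Y) (carrier N) ((\<lambda>D. D <+>\<^bsub>N\<^esub> Y) ` \<C>)"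
      using absorb[OF C(5)] YD(1) by (simp add: subset_iff)
    moreover have "p v = \<zero>\<^bsub>X\<^esub>" if "v \<in> carrier ?F" "\<phi> v \<in> Q" for v
      using inj that C(2)[OF A] by blast
    ultimately show ?thesis unfolding Y_def by blast
  qed
qed

text \<open>\<open>coherent N P\<close>: \<open>N/P\<close> is the direct limit of the filtered quotients \<open>N/Q\<close> with \<open>Q \<subseteq> P\<close>.\<close>

definition coherent :: "('r, 'b) module \<Rightarrow> 'b set \<Rightarrow> bool" where
  "coherent N P \<longleftrightarrow> (\<forall>S. finite S \<longrightarrow> S \<subseteq> P \<longrightarrow>
    (\<exists>Q \<C>. S \<subseteq> Q \<and> Q \<subseteq> P \<and> fchain N Q (carrier N) \<C>))"

lemma coherent_Union:
  assumes ch: "\<And>A B. A \<in> \<D> \<Longrightarrow> B \<in> \<D> \<Longrightarrow> A \<subseteq> B \<or> B \<subseteq> A" and ne: "\<D> \<noteq> {}"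
    and coh: "\<And>D. D \<in> \<D> \<Longrightarrow> coherent N D"
  shows "coherent N (\<Union>\<D>)"
  unfolding coherent_def
proof (intro allI impI)
  fix S assume S: "finite S" "S \<subseteq> \<Union>\<D>"
  have "subset.chain UNIV \<D>" using ch by (auto simp: subset_chain_def)
  then obtain D where D: "D \<in> \<D>" "S \<subseteq> D" using finite_subset_Union_chain[OF S ne] by blast
  then obtain Q \<C> where "S \<subseteq> Q" "Q \<subseteq> D" "fchain N Q (carrier N) \<C>"
    using coh[OF D(1)] S(1) unfolding coherent_def by meson
  then show "\<exists>Q \<C>. S \<subseteq> Q \<and> Q \<subseteq> \<Union>\<D> \<and> fchain N Q (carrier N) \<C>" using D(1) by blast
qed

lemma coherent_step:
  assumes M: "left_module R M" and N: "left_module R N" and f: "f \<in> lmod_hom R M N"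
    and A: "submodule A R M" and B: "submodule B R M"
    and st: "fstep M A B" and coh: "coherent N (f ` A)"
  shows "coherent N (f ` B)" "f ` B \<subseteq> f ` A \<or> (\<forall>b\<in>B. f b \<in> f ` A \<longrightarrow> b \<in> A)"
proof -
  interpret M: left_module R M by fact
  interpret N: left_module R N by fact
  interpret f: lmod_hom_pair R M N f by (rule lmod_hom_pairI[OF M N f])
  note AD = M.submoduleD[OF A] and BD = M.submoduleD[OF B]
  have AB: "A \<subseteq> B" using fstep_subset[OF st] by blast
  obtain X h where X: "X \<in> \<X>" and h: "h \<in> lmod_hom R (M\<lparr>carrier := B\<rparr>) X" "h ` B = carrier X"
    "{x \<in> B. h x = \<zero>\<^bsub>X\<^esub>} = A" using st by (rule fstepE)
  interpret X: left_module R X by (rule brick_left_module[OF X])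
  interpret B: left_module R "M\<lparr>carrier := B\<rparr>" by (rule M.left_module_submodule[OF B])
  interpret h: lmod_hom_pair R "M\<lparr>carrier := B\<rparr>" X h
    by (rule lmod_hom_pairI[OF B.left_module_axioms X.left_module_axioms h(1)])
  have "finitely_presented R X" using semibrick X by (auto simp: semibrick_def brick_def)
  then obtain m n k p where k: "k \<in> lmod_hom R (free_module R m) (free_module R n)"
    and p: "p \<in> lmod_hom R (free_module R n) X" "p ` carrier (free_module R n) = carrier X"
    and ex: "k ` carrier (free_module R m) = a_kernel (free_module R n) X p"
    unfolding finitely_presented_def by blast
  let ?F = "free_module R n"
  have "\<exists>b\<in>B. h b = p (unit_vec R n i)" for i
    using h(2) lmod_homD(1)[OF p(1) M.unit_vec_closed] by (metis imageE)
  then obtain b where b: "\<And>i. b i \<in> B" "\<And>i. h (b i) = p (unit_vec R n i)" by metis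
  obtain \<psi> where \<psi>: "\<psi> \<in> lmod_hom R ?F (M\<lparr>carrier := B\<rparr>)"
    "\<And>i. i < n \<Longrightarrow> \<psi> (unit_vec R n i) = b i"
    using B.free_module_hom_exists[of n b] b(1) by auto
  have h\<psi>: "h (\<psi> v) = p v" if "v \<in> carrier ?F" for v
    using X.hom_free_eqI[OF lmod_hom_comp[OF \<psi>(1) h(1)] p(1) _ that] \<psi>(2) b(2) by simp
  have \<psi>B: "\<psi> v \<in> B" if "v \<in> carrier ?F" for v using lmod_homD(1)[OF \<psi>(1) that] by simp
  have \<psi>M: "\<psi> \<in> lmod_hom R ?F M"
    using \<psi>(1) BD(1) by (auto simp: lmod_hom_def)
  define \<phi> where "\<phi> = f \<circ> \<psi>"
  have \<phi>: "\<phi> \<in> lmod_hom R ?F N" unfolding \<phi>_def by (rule lmod_hom_comp[OF \<psi>M f])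
  have dec: "\<exists>a\<in>A. \<exists>v\<in>carrier ?F. c = a \<oplus>\<^bsub>M\<^esub> \<psi> v \<and> h c = p v" if c: "c \<in> B" for c
  proof -
    obtain v where v: "v \<in> carrier ?F" "p v = h c" using p(2) h(2) c by (metis imageE imageI)
    have "c \<ominus>\<^bsub>M\<^esub> \<psi> v \<in> B" by (rule BD(6)[OF c \<psi>B[OF v(1)]])
    moreover have eq: "c = (c \<ominus>\<^bsub>M\<^esub> \<psi> v) \<oplus>\<^bsub>M\<^esub> \<psi> v"
      using M.add_diff_cancel[OF BD(1)[OF c] BD(1)[OF \<psi>B[OF v(1)]]] BD(1)[OF c] BD(1)[OF \<psi>B[OF v(1)]]
      by (simp add: M.M.a_comm)
    ultimately have "h c = h (c \<ominus>\<^bsub>M\<^esub> \<psi> v) \<oplus>\<^bsub>X\<^esub> h c"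
      using h.homD(2)[of "c \<ominus>\<^bsub>M\<^esub> \<psi> v" "\<psi> v"] \<psi>B[OF v(1)] h\<psi>[OF v(1)] v(2) by simp
    then have "h (c \<ominus>\<^bsub>M\<^esub> \<psi> v) = \<zero>\<^bsub>X\<^esub>"
      using h.homD(1)[of c] h.homD(1)[of "c \<ominus>\<^bsub>M\<^esub> \<psi> v"] c \<open>c \<ominus>\<^bsub>M\<^esub> \<psi> v \<in> B\<close> X.M.add.l_cancel_one'
      by simp
    then have "c \<ominus>\<^bsub>M\<^esub> \<psi> v \<in> A" using h(3) \<open>c \<ominus>\<^bsub>M\<^esub> \<psi> v \<in> B\<close> by blast
    then show ?thesis using eq v by metis
  qed
  have fdec: "f (a \<oplus>\<^bsub>M\<^esub> \<psi> v) = f a \<oplus>\<^bsub>N\<^esub> \<phi> v" if "a \<in> A" "v \<in> carrier ?F" for a v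
    using f.homD(2)[OF AD(1)[OF that(1)] BD(1)[OF \<psi>B[OF that(2)]]] by (simp add: \<phi>_def)
  have fA: "submodule (f ` A) R N" by (rule f.submodule_image[OF A])
  define G where "G = (\<lambda>j. \<phi> (k (unit_vec R m j))) ` {..<m}"
  have "\<phi> (k w) \<in> f ` A" if w: "w \<in> carrier (free_module R m)" for w
  proof -
    have kw: "k w \<in> carrier ?F" "p (k w) = \<zero>\<^bsub>X\<^esub>"
      using imageI[OF w, of k] unfolding ex a_kernel_iff by auto
    then have "\<psi> (k w) \<in> A" using h\<psi>[OF kw(1)] \<psi>B[OF kw(1)] h(3) by auto
    then show ?thesis by (simp add: \<phi>_def)
  qed
  then have G: "finite G" "G \<subseteq> f ` A" using M.unit_vec_closed by (auto simp: G_def)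
  have dich: "\<phi> ` carrier ?F \<subseteq> Q \<or> (\<forall>v\<in>carrier ?F. \<phi> v \<in> Q \<longrightarrow> p v = \<zero>\<^bsub>X\<^esub>) \<and>
      (\<exists>\<C>'. fchain N (Q <+>\<^bsub>N\<^esub> \<phi> ` carrier ?F) (carrier N) \<C>')"
    if GQ: "G \<subseteq> Q" and c: "fchain N Q (carrier N) \<C>" for Q \<C>
  proof (rule brick_map_dichotomy[OF N c X p \<phi>])
    fix v assume "v \<in> carrier ?F" "p v = \<zero>\<^bsub>X\<^esub>"
    then obtain w where w: "w \<in> carrier (free_module R m)" "v = k w"
      using ex a_kernel_iff[of v ?F X p] by (metis imageE)
    have "(\<phi> \<circ> k) w \<in> Q"
      using N.hom_free_range[OF lmod_hom_comp[OF k \<phi>] fchainD(1)[OF c fchainD(4)[OF c]] _ w(1)] GQ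
      by (auto simp: G_def)
    then show "\<phi> v \<in> Q" using w(2) by simp
  qed
  have "coherent N (f ` B) \<and> (f ` B \<subseteq> f ` A \<or> (\<forall>b\<in>B. f b \<in> f ` A \<longrightarrow> b \<in> A))"
  proof (cases "\<phi> ` carrier ?F \<subseteq> f ` A")
    case True
    have "f c \<in> f ` A" if c: "c \<in> B" for c
    proof -
      obtain a v where "a \<in> A" "v \<in> carrier ?F" "c = a \<oplus>\<^bsub>M\<^esub> \<psi> v" using dec[OF c] by blast
      then show ?thesis using fdec[of a v] N.submoduleD(3)[OF fA, of "f a" "\<phi> v"] True by auto
    qed
    then have "f ` B = f ` A" using AB by blast
    then show ?thesis using coh by simp
  next
    case False
    have inj: "c \<in> A" if c: "c \<in> B" "f c \<in> f ` A" for c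
    proof -
      obtain a v where av: "a \<in> A" "v \<in> carrier ?F" "c = a \<oplus>\<^bsub>M\<^esub> \<psi> v" "h c = p v"
        using dec[OF c(1)] by blast
      have "\<phi> v \<in> f ` A"
        using N.submodule_add_cancel[OF fA imageI[OF av(1)] lmod_homD(1)[OF \<phi> av(2)]]
          fdec[OF av(1,2)] av(3) c(2) by simp
      then have "finite (insert (\<phi> v) G)" "insert (\<phi> v) G \<subseteq> f ` A" using G by auto
      then obtain Q \<C> where Q: "insert (\<phi> v) G \<subseteq> Q" "Q \<subseteq> f ` A" "fchain N Q (carrier N) \<C>"
        using coh unfolding coherent_def by meson
      then have "p v = \<zero>\<^bsub>X\<^esub>" using dich[of Q \<C>] False av(2) by blast
      then show ?thesis using h(3) av(4) c(1) by auto
    qed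
    have "coherent N (f ` B)"
      unfolding coherent_def
    proof (intro allI impI)
      fix S assume S: "finite S" "S \<subseteq> f ` B"
      have "\<exists>a v. a \<in> A \<and> v \<in> carrier ?F \<and> s = f a \<oplus>\<^bsub>N\<^esub> \<phi> v" if s: "s \<in> S" for s
      proof -
        obtain c where c: "c \<in> B" "s = f c" using s S(2) by blast
        then show ?thesis using dec[OF c(1)] fdec by metis
      qed
      then obtain \<alpha> \<beta> where ab: "\<And>s. s \<in> S \<Longrightarrow> \<alpha> s \<in> A" "\<And>s. s \<in> S \<Longrightarrow> \<beta> s \<in> carrier ?F"
        "\<And>s. s \<in> S \<Longrightarrow> s = f (\<alpha> s) \<oplus>\<^bsub>N\<^esub> \<phi> (\<beta> s)" by metis
      have "finite ((\<lambda>s. f (\<alpha> s)) ` S \<union> G)" "(\<lambda>s. f (\<alpha> s)) ` S \<union> G \<subseteq> f ` A"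
        using G S(1) ab(1) by auto
      then obtain Q \<C> where Q: "(\<lambda>s. f (\<alpha> s)) ` S \<union> G \<subseteq> Q" "Q \<subseteq> f ` A" "fchain N Q (carrier N) \<C>"
        using coh unfolding coherent_def by meson
      then obtain \<C>' where C': "fchain N (Q <+>\<^bsub>N\<^esub> \<phi> ` carrier ?F) (carrier N) \<C>'"
        using dich[of Q \<C>] False by blast
      have "s \<in> Q <+>\<^bsub>N\<^esub> \<phi> ` carrier ?F" if s: "s \<in> S" for s
      proof -
        have "f (\<alpha> s) \<in> Q" using Q(1) s by blast
        moreover have "\<phi> (\<beta> s) \<in> \<phi> ` carrier ?F" using ab(2)[OF s] by blast
        ultimately show ?thesis using ab(3)[OF s] unfolding N.set_add_iff by blast
      qed
      moreover have "y \<in> f ` B" if y: "y \<in> Q <+>\<^bsub>N\<^esub> \<phi> ` carrier ?F" for y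
      proof -
        obtain a v where "a \<in> A" "v \<in> carrier ?F" "y = f a \<oplus>\<^bsub>N\<^esub> \<phi> v"
          using y Q(2) unfolding N.set_add_iff by blast
        then have "a \<oplus>\<^bsub>M\<^esub> \<psi> v \<in> B" "y = f (a \<oplus>\<^bsub>M\<^esub> \<psi> v)"
          using BD(3)[of a "\<psi> v"] AB \<psi>B[of v] fdec[of a v] by auto
        then show ?thesis by blast
      qed
      ultimately show "\<exists>Q \<C>. S \<subseteq> Q \<and> Q \<subseteq> f ` B \<and> fchain N Q (carrier N) \<C>" using C' by blast
    qed
    then show ?thesis using inj by blast
  qed
  then show "coherent N (f ` B)" "f ` B \<subseteq> f ` A \<or> (\<forall>b\<in>B. f b \<in> f ` A \<longrightarrow> b \<in> A)" by auto
qed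

lemma coherent_image:
  assumes M: "left_module R M" and N: "left_module R N" and f: "f \<in> lmod_hom R M N"
    and c: "fchain M {\<zero>\<^bsub>M\<^esub>} T \<C>" and d: "fchain N {\<zero>\<^bsub>N\<^esub>} (carrier N) \<D>" and A: "A \<in> \<C>"
  shows "coherent N (f ` A)"
  using c A
proof (induction rule: fchain_induct)
  case base
  have "f ` {\<zero>\<^bsub>M\<^esub>} = {\<zero>\<^bsub>N\<^esub>}" using lmod_hom_pair.hom_zero[OF lmod_hom_pairI[OF M N f]] by simp
  then show ?case using d unfolding coherent_def by auto
next
  case (step A B)
  then show ?case using coherent_step(1)[OF M N f fchainD(1)[OF c] fchainD(1)[OF c]] by blast
next
  case (union \<E>)
  have "coherent N (\<Union>((`) f ` \<E>))"
  proof (rule coherent_Union)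
    show "A \<subseteq> B \<or> B \<subseteq> A" if AB: "A \<in> (`) f ` \<E>" "B \<in> (`) f ` \<E>" for A B
    proof -
      obtain C D where "C \<in> \<E>" "D \<in> \<E>" "A = f ` C" "B = f ` D" using AB by blast
      then show ?thesis using fchainD(6)[OF c, of C D] union(1) by blast
    qed
  qed (use union in auto)
  moreover have "\<Union>((`) f ` \<E>) = f ` \<Union>\<E>" by blast
  ultimately show ?case by simp
qed

lemma fstep_image:
  assumes M: "left_module R M" and N: "left_module R N" and f: "f \<in> lmod_hom R M N"
    and A: "submodule A R M" and B: "submodule B R M" and st: "fstep M A B"
    and inj: "\<And>b. b \<in> B \<Longrightarrow> f b \<in> f ` A \<Longrightarrow> b \<in> A"
  shows "fstep N (f ` A) (f ` B)"
proof -
  interpret f: lmod_hom_pair R M N f by (rule lmod_hom_pairI[OF M N f])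
  note BD = f.M.submoduleD[OF B]
  show ?thesis
  proof (rule fstep_transfer[OF M N B f.submodule_image[OF B] _ st, of _ "\<lambda>b y. y = f b"])
    show "f ` A \<subseteq> f ` B" using fstep_subset[OF st] by blast
    show "\<zero>\<^bsub>N\<^esub> \<in> f ` A" by (rule f.N.submoduleD(2)[OF f.submodule_image[OF A]])
    show "b \<in> A \<longleftrightarrow> y \<in> f ` A" if "b \<in> B" "y = f b" for b y
      using inj[OF that(1)] imageI[of b A f] unfolding that(2) by blast
  qed (auto simp: f.homD(2,3) BD(1))
qed

lemma Filt_image:
  assumes M: "Filt R \<X> M" and N: "Filt R \<X> N" and f: "f \<in> lmod_hom R M N"
  shows "Filt R \<X> (N\<lparr>carrier := f ` carrier M\<rparr>)"
proof -
  obtain \<C> \<D> where lm: "left_module R M" "left_module R N"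
    and c: "fchain M {\<zero>\<^bsub>M\<^esub>} (carrier M) \<C>" and d: "fchain N {\<zero>\<^bsub>N\<^esub>} (carrier N) \<D>"
    using M N unfolding Filt_iff_fchain by blast
  interpret f: lmod_hom_pair R M N f by (rule lmod_hom_pairI[OF lm f])
  have T: "submodule (f ` carrier M) R N" by (rule f.submodule_image[OF f.M.submodule_carrier])
  have "fchain N (f ` {\<zero>\<^bsub>M\<^esub>}) (f ` carrier M) ((`) f ` \<C>)"
  proof (rule fchain_map[OF c])
    fix A B assume AB: "A \<in> \<C>" "B \<in> \<C>" "fstep M A B"
    note sub = fchainD(1)[OF c AB(1)] fchainD(1)[OF c AB(2)]
    show "f ` B \<subseteq> f ` A \<or> fstep N (f ` A) (f ` B)"
      using coherent_step(2)[OF lm f sub AB(3) coherent_image[OF lm f c d AB(1)]]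
        fstep_image[OF lm f sub AB(3)] by blast
  qed (use f.submodule_image fchainD(1)[OF c] in auto)
  then have "fchain (N\<lparr>carrier := f ` carrier M\<rparr>) {\<zero>\<^bsub>N\<^esub>} (f ` carrier M) ((`) f ` \<C>)"
    using fchain_restrict[OF lm(2)] f.hom_zero by simp
  then show ?thesis using f.N.left_module_submodule[OF T] unfolding Filt_iff_fchain by auto
qed

lemma Filt_kernel:
  assumes M: "Filt R \<X> M" and N: "Filt R \<X> N" and f: "f \<in> lmod_hom R M N"
  shows "Filt R \<X> (M\<lparr>carrier := a_kernel M N f\<rparr>)"
proof -
  obtain \<C> \<D> where lm: "left_module R M" "left_module R N"
    and c: "fchain M {\<zero>\<^bsub>M\<^esub>} (carrier M) \<C>" and d: "fchain N {\<zero>\<^bsub>N\<^esub>} (carrier N) \<D>"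
    using M N unfolding Filt_iff_fchain by blast
  interpret f: lmod_hom_pair R M N f by (rule lmod_hom_pairI[OF lm f])
  define K where "K = a_kernel M N f"
  have K: "submodule K R M" unfolding K_def by (rule f.submodule_kernel)
  note KD = f.M.submoduleD[OF K]
  have "fchain M ({\<zero>\<^bsub>M\<^esub>} \<inter> K) (carrier M \<inter> K) ((\<lambda>A. A \<inter> K) ` \<C>)"
  proof (rule fchain_map[OF c])
    fix A B assume AB: "A \<in> \<C>" "B \<in> \<C>" "fstep M A B"
    note sub = fchainD(1)[OF c AB(1)] fchainD(1)[OF c AB(2)]
    note AD = f.M.submoduleD[OF sub(1)] and BD = f.M.submoduleD[OF sub(2)]
    have le: "A \<subseteq> B" using fstep_subset[OF AB(3)] by blast
    consider "f ` B \<subseteq> f ` A" | "\<forall>b\<in>B. f b \<in> f ` A \<longrightarrow> b \<in> A"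
      using coherent_step(2)[OF lm f sub AB(3) coherent_image[OF lm f c d AB(1)]] by blast
    then show "B \<inter> K \<subseteq> A \<inter> K \<or> fstep M (A \<inter> K) (B \<inter> K)"
    proof cases
      case 1
      have "fstep M (A \<inter> K) (B \<inter> K)"
      proof (rule fstep_transfer[OF lm(1) lm(1) sub(2) f.M.submodule_Int[OF sub(2) K] _ AB(3),
            of _ "\<lambda>b y. \<exists>a\<in>A. b = a \<oplus>\<^bsub>M\<^esub> y"])
        show "A \<inter> K \<subseteq> B \<inter> K" using le by blast
        show "\<zero>\<^bsub>M\<^esub> \<in> A \<inter> K" using AD(2) KD(2) by blast
        show "\<exists>b\<in>B. \<exists>a\<in>A. b = a \<oplus>\<^bsub>M\<^esub> y" if "y \<in> B \<inter> K" for y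
          using that AD(2) f.M.M.l_zero[OF BD(1), of y] by (metis IntD1)
        show "\<exists>y\<in>B \<inter> K. \<exists>a\<in>A. b = a \<oplus>\<^bsub>M\<^esub> y" if b: "b \<in> B" for b
        proof -
          obtain a where a: "a \<in> A" "f b = f a" using 1 b by blast
          have cr: "b \<in> carrier M" "a \<in> carrier M" using BD(1)[OF b] AD(1)[OF a(1)] by auto
          have "b \<ominus>\<^bsub>M\<^esub> a \<in> B" using BD(6)[OF b] le a(1) by blast
          moreover have "b \<ominus>\<^bsub>M\<^esub> a \<in> K" using f.hom_eq_iff[OF cr] a(2) cr by (simp add: K_def a_kernel_iff)
          ultimately show ?thesis using f.M.add_diff_cancel[OF cr] a(1) by (metis IntI)
        qed
      next
        fix b b' y y' assume y: "y \<in> B \<inter> K" "y' \<in> B \<inter> K"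
          and "\<exists>a\<in>A. b = a \<oplus>\<^bsub>M\<^esub> y" "\<exists>a\<in>A. b' = a \<oplus>\<^bsub>M\<^esub> y'"
        then obtain a a' where a: "a \<in> A" "a' \<in> A" "b = a \<oplus>\<^bsub>M\<^esub> y" "b' = a' \<oplus>\<^bsub>M\<^esub> y'" by blast
        have "b \<oplus>\<^bsub>M\<^esub> b' = (a \<oplus>\<^bsub>M\<^esub> a') \<oplus>\<^bsub>M\<^esub> (y \<oplus>\<^bsub>M\<^esub> y')"
          using AD(1)[OF a(1)] AD(1)[OF a(2)] BD(1)[of y] BD(1)[of y'] y a(3,4)
          by (simp add: f.M.M.a_ac)
        then show "\<exists>a\<in>A. b \<oplus>\<^bsub>M\<^esub> b' = a \<oplus>\<^bsub>M\<^esub> (y \<oplus>\<^bsub>M\<^esub> y')" using AD(3)[OF a(1,2)] by blast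
      next
        fix r b y assume r: "r \<in> carrier R" and y: "y \<in> B \<inter> K" and "\<exists>a\<in>A. b = a \<oplus>\<^bsub>M\<^esub> y"
        then obtain a where a: "a \<in> A" "b = a \<oplus>\<^bsub>M\<^esub> y" by blast
        then show "\<exists>a\<in>A. r \<odot>\<^bsub>M\<^esub> b = a \<oplus>\<^bsub>M\<^esub> (r \<odot>\<^bsub>M\<^esub> y)"
          using f.M.smult_r_distr[OF r AD(1)[OF a(1)], of y] BD(1)[of y] y AD(4)[OF r a(1)] by blast
      next
        fix b y assume y: "y \<in> B \<inter> K" and "\<exists>a\<in>A. b = a \<oplus>\<^bsub>M\<^esub> y"
        then obtain a where a: "a \<in> A" "b = a \<oplus>\<^bsub>M\<^esub> y" by blast
        then show "b \<in> A \<longleftrightarrow> y \<in> A \<inter> K"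
          using f.M.submodule_add_cancel[OF sub(1) a(1), of y] AD(3)[OF a(1), of y] BD(1)[of y] y by blast
      qed
      then show ?thesis ..
    next
      case 2
      have "f b \<in> f ` A" if "b \<in> K" for b
        using that f.hom_zero imageI[OF AD(2), of f] by (simp add: K_def a_kernel_iff)
      then show ?thesis using 2 by blast
    qed
  qed (use f.M.submodule_Int[OF _ K] fchainD(1)[OF c] in auto)
  moreover have "{\<zero>\<^bsub>M\<^esub>} \<inter> K = {\<zero>\<^bsub>M\<^esub>}" "carrier M \<inter> K = K" using KD(1,2) by auto
  ultimately have "fchain (M\<lparr>carrier := K\<rparr>) {\<zero>\<^bsub>M\<^esub>} K ((\<lambda>A. A \<inter> K) ` \<C>)"
    using fchain_restrict[OF lm(1)] by simp
  then show ?thesis using f.M.left_module_submodule[OF K] unfolding Filt_iff_fchain K_def by auto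
qed

lemma Filt_extension:
  assumes M: "left_module R M" and L: "Filt R \<X> L" and N: "Filt R \<X> N"
    and ex: "short_exact R L f M g N"
  shows "Filt R \<X> M"
proof -
  obtain \<C> \<D> where lm: "left_module R L" "left_module R N"
    and c: "fchain L {\<zero>\<^bsub>L\<^esub>} (carrier L) \<C>" and d: "fchain N {\<zero>\<^bsub>N\<^esub>} (carrier N) \<D>"
    using L N unfolding Filt_iff_fchain by blast
  have f: "f \<in> lmod_hom R L M" and g: "g \<in> lmod_hom R M N" and inj: "inj_on f (carrier L)"
    and im: "f ` carrier L = a_kernel M N g" and surj: "g ` carrier M = carrier N"
    using ex unfolding short_exact_def by auto
  interpret f: lmod_hom_pair R L M f by (rule lmod_hom_pairI[OF lm(1) M f])
  interpret g: lmod_hom_pair R M N g by (rule lmod_hom_pairI[OF M lm(2) g])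
  have "fchain M (f ` {\<zero>\<^bsub>L\<^esub>}) (f ` carrier L) ((`) f ` \<C>)"
  proof (rule fchain_map[OF c])
    fix A B assume AB: "A \<in> \<C>" "B \<in> \<C>" "fstep L A B"
    have "b \<in> A" if b: "b \<in> B" "f b \<in> f ` A" for b
      using b inj_on_image_mem_iff[OF inj] fchainD(3)[OF c AB(1)] fchainD(3)[OF c AB(2)] by blast
    then show "f ` B \<subseteq> f ` A \<or> fstep M (f ` A) (f ` B)"
      using fstep_image[OF lm(1) M f fchainD(1)[OF c AB(1)] fchainD(1)[OF c AB(2)] AB(3)] by blast
  qed (use f.submodule_image fchainD(1)[OF c] in auto)
  then have fc: "fchain M {\<zero>\<^bsub>M\<^esub>} (a_kernel M N g) ((`) f ` \<C>)" using f.hom_zero im by simp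
  let ?\<Phi> = "\<lambda>B. {x \<in> carrier M. g x \<in> B}"
  have "fchain M (?\<Phi> {\<zero>\<^bsub>N\<^esub>}) (?\<Phi> (carrier N)) (?\<Phi> ` \<D>)"
  proof (rule fchain_map[OF d])
    show "submodule (?\<Phi> B) R M" if "B \<in> \<D>" for B by (rule g.submodule_vimage[OF fchainD(1)[OF d that]])
    show "?\<Phi> (\<Union>\<E>) = \<Union>(?\<Phi> ` \<E>)" for \<E> by blast
    fix A B assume AB: "A \<in> \<D>" "B \<in> \<D>" "fstep N A B"
    note sub = fchainD(1)[OF d AB(1)] fchainD(1)[OF d AB(2)]
    have "fstep M (?\<Phi> A) (?\<Phi> B)"
    proof (rule fstep_transfer[OF lm(2) M sub(2) g.submodule_vimage[OF sub(2)] _ AB(3),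
          of _ "\<lambda>b y. b = g y"])
      show "?\<Phi> A \<subseteq> ?\<Phi> B" using fstep_subset[OF AB(3)] by blast
      show "\<zero>\<^bsub>M\<^esub> \<in> ?\<Phi> A" using g.N.submoduleD(2)[OF sub(1)] g.hom_zero by simp
      show "\<exists>y\<in>?\<Phi> B. b = g y" if b: "b \<in> B" for b
      proof -
        have "b \<in> g ` carrier M" using surj g.N.submoduleD(1)[OF sub(2) b] by simp
        then show ?thesis using b by blast
      qed
    qed (use g.homD(2,3) in auto)
    then show "?\<Phi> B \<subseteq> ?\<Phi> A \<or> fstep M (?\<Phi> A) (?\<Phi> B)" ..
  qed
  moreover have "?\<Phi> {\<zero>\<^bsub>N\<^esub>} = a_kernel M N g" by (auto simp: a_kernel_iff)
  moreover have "?\<Phi> (carrier N) = carrier M" using g.homD(1) by blast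
  ultimately have "fchain M (a_kernel M N g) (carrier M) (?\<Phi> ` \<D>)" by simp
  from fchain_glue[OF fc this] show ?thesis using M unfolding Filt_iff_fchain by blast
qed

end

theorem proposition3p9:
  fixes R :: "('r, 'k) ring_scheme"
    and \<X> :: "('r, 'x) module set"
  assumes "ring R"
    and "semibrick R \<X>"
  shows
    "(\<forall>(L :: ('r, 'a) module) (M :: ('r, 'b) module) (N :: ('r, 'c) module) f g.
        left_module R M \<longrightarrow> Filt R \<X> L \<longrightarrow> Filt R \<X> N \<longrightarrow> short_exact R L f M g N \<longrightarrow> Filt R \<X> M) \<and>
     (\<forall>(M :: ('r, 'd) module) (N :: ('r, 'e) module) f.
        Filt R \<X> M \<longrightarrow> Filt R \<X> N \<longrightarrow> f \<in> lmod_hom R M N \<longrightarrow>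
          Filt R \<X> (M\<lparr>carrier := a_kernel M N f\<rparr>)) \<and>
     (\<forall>(M :: ('r, 'd) module) (N :: ('r, 'e) module) f.
        Filt R \<X> M \<longrightarrow> Filt R \<X> N \<longrightarrow> f \<in> lmod_hom R M N \<longrightarrow>
          Filt R \<X> (N\<lparr>carrier := f ` carrier M\<rparr>))"
proof -
  interpret semibrick_context R \<X> using assms by (rule semibrick_context.intro)
  show ?thesis using Filt_extension Filt_kernel Filt_image by blast
qed

end
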